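(* The adversarial recoverable selection problem \textsc{AREC} under the discrete budgeted uncertainty set $\mathcal{U}^d$, i.e. the problem, for a given $\mathbf{x}\in\Phi$, $$\max_{\mathbf{c}\in\mathcal{U}^d}\ \min_{\mathbf{y}\in\Phi^k_{\mathbf{x}}}\mathbf{c}\mathbf{y},$$ can be solved in $O(n^3)$ time.
   Context: Let $[n]=\{1,\dots,n\}$ and $p\in[n]$. The input consists of $n$, $p$, a recovery parameter $k\in[p]\cup\{0\}$, a vector $\mathbf{x}\in\Phi$, nonnegative item costs $\underline{c}_i\le\overline{c}_i$ with $d_i=\overline{c}_i-\underline{c}_i\ge 0$ for $i\in[n]$, and a budget $\Gamma\ge 0$. Products such as $\mathbf{c}\mathbf{y}$ denote $\sum_{i\in[n]}c_iy_i$. $\Phi=\{\mathbf{x}\in\{0,1\}^n:\sum_{i\in[n]}x_i=p\}$. For $\mathbf{x}\in\Phi$, $\Phi^k_{\mathbf{x}}=\{\mathbf{y}\in\{0,1\}^n:\sum_{i\in[n]}y_i=p,\ \sum_{i\in[n]}x_iy_i\ge p-k\}$. The discrete budgeted uncertainty set is $\mathcal{U}^d=\{(\underline{c}_i+\delta_i)_{i\in[n]}:\delta_i\in\{0,d_i\},\ |\{i\in[n]:\delta_i=d_i\}|\le\Gamma\}$ (that is, at most $\Gamma$ of the items may have their cost raised from $\underline{c}_i$ to $\overline{c}_i$). Running time counts elementary arithmetic operations and comparisons on the input numbers (standard unit-cost model). *)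

theory Defs
  imports Complex_Main "HOL-Library.FuncSet" "HOL-Library.Landau_Symbols"
begin

section \<open>The adversarial recoverable selection problem\<close>

text \<open>
  Vectors are functions on \<open>{1..n}\<close>; extensionality keeps the sets of vectors finite. The
  subtraction \<open>p - k\<close> is exact, since instances satisfy \<open>k \<le> p\<close>.
\<close>

definition sel :: "nat \<Rightarrow> nat \<Rightarrow> (nat \<Rightarrow> nat) set" where
  "sel n p = {x \<in> {1..n} \<rightarrow>\<^sub>E {0, 1}. (\<Sum>i\<in>{1..n}. x i) = p}"

definition sel_rec :: "nat \<Rightarrow> nat \<Rightarrow> nat \<Rightarrow> (nat \<Rightarrow> nat) \<Rightarrow> (nat \<Rightarrow> nat) set" where
  "sel_rec n p k x =
     {y \<in> {1..n} \<rightarrow>\<^sub>E {0, 1}. (\<Sum>i\<in>{1..n}. y i) = p \<and> (\<Sum>i\<in>{1..n}. x i * y i) \<ge> p - k}"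

text \<open>
  The budget bounds the number of items whose cost is actually raised. Items with
  \<open>hi i = lo i\<close> are never raised, so they are not counted; otherwise the set could be
  empty merely because there are many such items. The budget need not be an integer.
\<close>

definition scenarios ::
  "nat \<Rightarrow> (nat \<Rightarrow> real) \<Rightarrow> (nat \<Rightarrow> real) \<Rightarrow> real \<Rightarrow> (nat \<Rightarrow> real) set" where
  "scenarios n lo hi \<Gamma> =
     {restrict (\<lambda>i. lo i + \<delta> i) {1..n} | \<delta>.
        (\<forall>i\<in>{1..n}. \<delta> i \<in> {0, hi i - lo i}) \<and> real (card {i \<in> {1..n}. \<delta> i \<noteq> 0}) \<le> \<Gamma>}"

definition cost :: "nat \<Rightarrow> (nat \<Rightarrow> real) \<Rightarrow> (nat \<Rightarrow> nat) \<Rightarrow> real" where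
  "cost n c y = (\<Sum>i\<in>{1..n}. c i * real (y i))"

definition rec_cost :: "nat \<Rightarrow> nat \<Rightarrow> nat \<Rightarrow> (nat \<Rightarrow> nat) \<Rightarrow> (nat \<Rightarrow> real) \<Rightarrow> real" where
  "rec_cost n p k x c = Min (cost n c ` sel_rec n p k x)"

definition arec_value ::
  "nat \<Rightarrow> nat \<Rightarrow> nat \<Rightarrow> (nat \<Rightarrow> nat) \<Rightarrow> (nat \<Rightarrow> real) \<Rightarrow> (nat \<Rightarrow> real) \<Rightarrow> real \<Rightarrow> real" where
  "arec_value n p k x lo hi \<Gamma> = Max (rec_cost n p k x ` scenarios n lo hi \<Gamma>)"

definition arec_instance ::
  "nat \<Rightarrow> nat \<Rightarrow> nat \<Rightarrow> (nat \<Rightarrow> nat) \<Rightarrow> (nat \<Rightarrow> real) \<Rightarrow> (nat \<Rightarrow> real) \<Rightarrow> real \<Rightarrow> bool" where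
  "arec_instance n p k x lo hi \<Gamma> \<longleftrightarrow>
     p \<in> {1..n} \<and> k \<le> p \<and> x \<in> sel n p \<and> (\<forall>i\<in>{1..n}. 0 \<le> lo i \<and> lo i \<le> hi i) \<and> 0 \<le> \<Gamma>"

text \<open>The minimum and the maximum range over finite nonempty sets.\<close>

lemma finite_sel_rec: "finite (sel_rec n p k x)"
  unfolding sel_rec_def by (rule finite_subset[OF _ finite_PiE[of "{1..n}" "\<lambda>_. {0, 1}"]]) auto

lemma sel_rec_nonempty:
  assumes "x \<in> sel n p"
  shows "sel_rec n p k x \<noteq> {}"
proof -
  have "x i * x i = x i" if "i \<in> {1..n}" for i
    using assms that unfolding sel_def by (auto simp: PiE_iff)
  then have "(\<Sum>i\<in>{1..n}. x i * x i) = p"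
    using assms sum.cong[of "{1..n}" "{1..n}" "\<lambda>i. x i * x i" x] unfolding sel_def by simp
  then have "x \<in> sel_rec n p k x"
    using assms unfolding sel_def sel_rec_def by auto
  then show ?thesis by blast
qed

lemma finite_scenarios: "finite (scenarios n lo hi \<Gamma>)"
proof (rule finite_subset)
  show "scenarios n lo hi \<Gamma> \<subseteq> (\<Pi>\<^sub>E i\<in>{1..n}. {lo i, hi i})"
    unfolding scenarios_def by (fastforce simp: PiE_iff)
  show "finite (\<Pi>\<^sub>E i\<in>{1..n}. {lo i, hi i})"
    by (rule finite_PiE) auto
qed

lemma scenarios_nonempty:
  assumes "0 \<le> \<Gamma>"
  shows "scenarios n lo hi \<Gamma> \<noteq> {}"
  using assms unfolding scenarios_def by (auto intro!: exI[of _ "\<lambda>_. 0"])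


section \<open>A unit-cost random access machine over the reals\<close>

text \<open>
  Programs work on named, unbounded arrays of natural numbers (indices and counters) and of
  real numbers; a scalar variable is cell \<open>0\<close> of an array. Reals are handled only by
  exact field arithmetic and comparisons: there is no rounding, no conversion from reals to
  naturals, and the only constants are natural numbers, so that a program cannot carry
  information in the digits of a real constant. Division by zero gives zero.
\<close>

type_synonym vname = string

record state =
  nats :: "vname \<Rightarrow> nat \<Rightarrow> nat"
  reals :: "vname \<Rightarrow> nat \<Rightarrow> real"

datatype nexp =
    NConst nat
  | NCell vname nexp
  | NAdd nexp nexp
  | NSub nexp nexp
  | NMul nexp nexp

datatype rexp =
    ROfNat nexp
  | RCell vname nexp
  | RAdd rexp rexp
  | RSub rexp rexp
  | RMul rexp rexp
  | RDiv rexp rexp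

datatype bexp =
    NLess nexp nexp
  | NEq nexp nexp
  | RLess rexp rexp
  | REq rexp rexp
  | BNot bexp
  | BAnd bexp bexp

datatype com =
    Skip
  | NAssign vname nexp nexp
  | RAssign vname nexp rexp
  | Seq com com
  | Cond bexp com com
  | While bexp com

fun nval :: "nexp \<Rightarrow> state \<Rightarrow> nat" where
  "nval (NConst m) s = m"
| "nval (NCell a i) s = nats s a (nval i s)"
| "nval (NAdd e f) s = nval e s + nval f s"
| "nval (NSub e f) s = nval e s - nval f s"
| "nval (NMul e f) s = nval e s * nval f s"

fun rval :: "rexp \<Rightarrow> state \<Rightarrow> real" where
  "rval (ROfNat e) s = real (nval e s)"
| "rval (RCell a i) s = reals s a (nval i s)"
| "rval (RAdd e f) s = rval e s + rval f s"
| "rval (RSub e f) s = rval e s - rval f s"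
| "rval (RMul e f) s = rval e s * rval f s"
| "rval (RDiv e f) s = rval e s / rval f s"

fun bval :: "bexp \<Rightarrow> state \<Rightarrow> bool" where
  "bval (NLess e f) s \<longleftrightarrow> nval e s < nval f s"
| "bval (NEq e f) s \<longleftrightarrow> nval e s = nval f s"
| "bval (RLess e f) s \<longleftrightarrow> rval e s < rval f s"
| "bval (REq e f) s \<longleftrightarrow> rval e s = rval f s"
| "bval (BNot b) s \<longleftrightarrow> \<not> bval b s"
| "bval (BAnd b c) s \<longleftrightarrow> bval b s \<and> bval c s"

text \<open>Every constant, memory access, arithmetic operation, comparison and connective costs 1.\<close>

fun ncost :: "nexp \<Rightarrow> nat" where
  "ncost (NConst m) = 1"
| "ncost (NCell a i) = 1 + ncost i"
| "ncost (NAdd e f) = 1 + ncost e + ncost f"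
| "ncost (NSub e f) = 1 + ncost e + ncost f"
| "ncost (NMul e f) = 1 + ncost e + ncost f"

fun rcost :: "rexp \<Rightarrow> nat" where
  "rcost (ROfNat e) = 1 + ncost e"
| "rcost (RCell a i) = 1 + ncost i"
| "rcost (RAdd e f) = 1 + rcost e + rcost f"
| "rcost (RSub e f) = 1 + rcost e + rcost f"
| "rcost (RMul e f) = 1 + rcost e + rcost f"
| "rcost (RDiv e f) = 1 + rcost e + rcost f"

fun bcost :: "bexp \<Rightarrow> nat" where
  "bcost (NLess e f) = 1 + ncost e + ncost f"
| "bcost (NEq e f) = 1 + ncost e + ncost f"
| "bcost (RLess e f) = 1 + rcost e + rcost f"
| "bcost (REq e f) = 1 + rcost e + rcost f"
| "bcost (BNot b) = 1 + bcost b"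
| "bcost (BAnd b c) = 1 + bcost b + bcost c"

definition nat_upd :: "vname \<Rightarrow> nat \<Rightarrow> nat \<Rightarrow> state \<Rightarrow> state" where
  "nat_upd a i v s = s\<lparr>nats := (nats s)(a := (nats s a)(i := v))\<rparr>"

definition real_upd :: "vname \<Rightarrow> nat \<Rightarrow> real \<Rightarrow> state \<Rightarrow> state" where
  "real_upd a i v s = s\<lparr>reals := (reals s)(a := (reals s a)(i := v))\<rparr>"

text \<open>\<open>exec c s t s'\<close>: started in \<open>s\<close>, program \<open>c\<close> halts in \<open>s'\<close> after \<open>t\<close> elementary steps.\<close>

inductive exec :: "com \<Rightarrow> state \<Rightarrow> nat \<Rightarrow> state \<Rightarrow> bool" where
  Skip: "exec Skip s 1 s"
| NAssign: "exec (NAssign a i e) s (1 + ncost i + ncost e) (nat_upd a (nval i s) (nval e s) s)"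
| RAssign: "exec (RAssign a i e) s (1 + ncost i + rcost e) (real_upd a (nval i s) (rval e s) s)"
| Seq: "exec c s t s' \<Longrightarrow> exec d s' u s'' \<Longrightarrow> exec (Seq c d) s (t + u) s''"
| CondTrue: "bval b s \<Longrightarrow> exec c s t s' \<Longrightarrow> exec (Cond b c d) s (1 + bcost b + t) s'"
| CondFalse: "\<not> bval b s \<Longrightarrow> exec d s t s' \<Longrightarrow> exec (Cond b c d) s (1 + bcost b + t) s'"
| WhileFalse: "\<not> bval b s \<Longrightarrow> exec (While b c) s (1 + bcost b) s"
| WhileTrue: "bval b s \<Longrightarrow> exec c s t s' \<Longrightarrow> exec (While b c) s' u s'' \<Longrightarrow>
    exec (While b c) s (1 + bcost b + t + u) s''"

inductive_cases SkipE: "exec Skip s t s'"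
inductive_cases NAssignE: "exec (NAssign a i e) s t s'"
inductive_cases RAssignE: "exec (RAssign a i e) s t s'"
inductive_cases SeqE: "exec (Seq c d) s t s'"
inductive_cases CondE: "exec (Cond b c d) s t s'"
inductive_cases WhileE: "exec (While b c) s t s'"

lemma exec_deterministic:
  "exec c s t s' \<Longrightarrow> exec c s u s'' \<Longrightarrow> u = t \<and> s'' = s'"
proof (induction arbitrary: u s'' rule: exec.induct)
  case (Seq c s t s' d v s1)
  from Seq.prems obtain t1 t2 r where "exec c s t1 r" "exec d r t2 s''" "u = t1 + t2"
    by (rule SeqE)
  with Seq.IH(1)[of t1 r] Seq.IH(2)[of t2 s''] show ?case by simp
next
  case (CondTrue b s c t s' d)
  from CondTrue.prems CondTrue.hyps obtain t1 where "exec c s t1 s''" "u = 1 + bcost b + t1"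
    by (auto elim: CondE)
  with CondTrue.IH[of t1 s''] show ?case by simp
next
  case (CondFalse b s d t s' c)
  from CondFalse.prems CondFalse.hyps obtain t1 where "exec d s t1 s''" "u = 1 + bcost b + t1"
    by (auto elim: CondE)
  with CondFalse.IH[of t1 s''] show ?case by simp
next
  case (WhileFalse b s c)
  from WhileFalse.prems show ?case by (rule WhileE) (use WhileFalse.hyps in auto)
next
  case (WhileTrue b s c t s' v s1)
  from WhileTrue.prems
  obtain t1 t2 r where "exec c s t1 r" "exec (While b c) r t2 s''" "u = 1 + bcost b + t1 + t2"
    by (rule WhileE) (use WhileTrue.hyps(1) in auto)
  with WhileTrue.IH(1)[of t1 r] WhileTrue.IH(2)[of t2 s''] show ?case by simp
qed (auto elim: SkipE NAssignE RAssignE)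


section \<open>Input and output of programs for the problem\<close>

text \<open>Cells not mentioned here have arbitrary initial contents.\<close>

definition arec_input ::
  "nat \<Rightarrow> nat \<Rightarrow> nat \<Rightarrow> (nat \<Rightarrow> nat) \<Rightarrow> (nat \<Rightarrow> real) \<Rightarrow> (nat \<Rightarrow> real) \<Rightarrow> real \<Rightarrow> state \<Rightarrow> bool" where
  "arec_input n p k x lo hi \<Gamma> s \<longleftrightarrow>
     nats s ''n'' 0 = n \<and> nats s ''p'' 0 = p \<and> nats s ''k'' 0 = k \<and> reals s ''Gamma'' 0 = \<Gamma> \<and>
     (\<forall>i\<in>{1..n}. nats s ''x'' i = x i \<and> reals s ''lo'' i = lo i \<and> reals s ''hi'' i = hi i)"

text \<open>The program has to return the optimal value together with a scenario attaining it.\<close>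

definition arec_output ::
  "nat \<Rightarrow> nat \<Rightarrow> nat \<Rightarrow> (nat \<Rightarrow> nat) \<Rightarrow> (nat \<Rightarrow> real) \<Rightarrow> (nat \<Rightarrow> real) \<Rightarrow> real \<Rightarrow> state \<Rightarrow> bool" where
  "arec_output n p k x lo hi \<Gamma> s \<longleftrightarrow>
     reals s ''value'' 0 = arec_value n p k x lo hi \<Gamma> \<and>
     (\<exists>c \<in> scenarios n lo hi \<Gamma>. (\<forall>i\<in>{1..n}. reals s ''c'' i = c i) \<and>
        rec_cost n p k x c = arec_value n p k x lo hi \<Gamma>)"

end

theory Submission
  imports Defs
begin

text \<open>
  For fixed costs \<open>c\<close>, linear programming duality for the inner problem says that its value is the
  maximum over thresholds \<open>v\<^sub>0 \<le> v\<^sub>1\<close> of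
  \<open>(p - k) v\<^sub>1 + k v\<^sub>0 + \<Sum>\<^bsub>x i = 1\<^esub> min 0 (c i - v\<^sub>1) + \<Sum>\<^bsub>x i = 0\<^esub> min 0 (c i - v\<^sub>0)\<close>,
  and the maximum is attained at thresholds that are themselves costs of items. Hence the adversary
  only has to consider the \<open>2n\<close> numbers \<open>lo i\<close>, \<open>hi i\<close> as thresholds. For each threshold and each of
  the two sides \<open>x i = 1\<close>, \<open>x i = 0\<close>, a knapsack-like dynamic program over items and budget computes
  the best contribution of that side for every number of raised items, in \<open>O(n\<^sup>2)\<close> steps. All triples
  of two thresholds and a splitting of the budget between the sides are then tried in \<open>O(n\<^sup>3)\<close> steps,
  and an optimal scenario is read off by tracing back through the two tables.
\<close>

section \<open>Duality for the inner minimization problem\<close>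

lemma finite_arg_max:
  fixes c :: "'a \<Rightarrow> 'b::linorder"
  assumes "finite A" "A \<noteq> {}"
  obtains i where "i \<in> A" "\<And>a. a \<in> A \<Longrightarrow> c a \<le> c i"
  using Max_in[of "c ` A"] Max_ge[of "c ` A"] assms by fastforce

lemma finite_arg_min:
  fixes c :: "'a \<Rightarrow> 'b::linorder"
  assumes "finite A" "A \<noteq> {}"
  obtains i where "i \<in> A" "\<And>a. a \<in> A \<Longrightarrow> c i \<le> c a"
  using Min_in[of "c ` A"] Min_le[of "c ` A"] assms by fastforce

text \<open>Both removed and added weights stay on the side where they are added, so that the
  identity holds in semirings without subtraction. It is applied with weights 1, \<open>x\<close>
  and \<open>c\<close>.\<close>

lemma sum_swap:
  fixes f :: "nat \<Rightarrow> 'a::comm_semiring_1" and y :: "nat \<Rightarrow> nat"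
  assumes "finite A" "i \<in> A" "l \<in> A" "y i = 1" "y l = 0"
  shows "(\<Sum>j\<in>A. f j * of_nat ((y(i := 0, l := 1)) j)) + f i = (\<Sum>j\<in>A. f j * of_nat (y j)) + f l"
proof -
  have il: "i \<noteq> l"
    using assms by auto
  let ?B = "A - {i} - {l}"
  have split: "(\<Sum>j\<in>A. g j) = g i + (g l + (\<Sum>j\<in>?B. g j))" for g :: "nat \<Rightarrow> 'a"
    using assms il by (simp add: sum.remove[of A i] sum.remove[of "A - {i}" l])
  have "(\<Sum>j\<in>?B. f j * of_nat ((y(i := 0, l := 1)) j)) = (\<Sum>j\<in>?B. f j * of_nat (y j))"
    by (rule sum.cong) auto
  then show ?thesis
    using assms il unfolding split by (simp add: algebra_simps)
qed

locale arec =
  fixes n p k :: nat and x :: "nat \<Rightarrow> nat" and lo hi :: "nat \<Rightarrow> real" and \<Gamma> :: real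
  assumes instance_ok: "arec_instance n p k x lo hi \<Gamma>"
begin

lemma p_pos: "0 < p" and k_le: "k \<le> p" and \<Gamma>_nonneg: "0 \<le> \<Gamma>" and p_le: "p \<le> n"
  using instance_ok unfolding arec_instance_def by auto

lemma n_pos: "0 < n"
  using p_pos p_le by simp

lemma x_cases: "i \<in> {1..n} \<Longrightarrow> x i = 0 \<or> x i = 1"
  using instance_ok unfolding arec_instance_def sel_def by (auto simp: PiE_iff)

lemma y_cases: "y \<in> sel_rec n p k x \<Longrightarrow> i \<in> {1..n} \<Longrightarrow> y i = 0 \<or> y i = 1"
  unfolding sel_rec_def by (auto simp: PiE_iff)

text \<open>For a fixed threshold \<open>v\<close> this is the best value of the dual variable of
  the constraint \<open>y i \<le> 1\<close>, restricted to the side \<open>x i = \<sigma>\<close>.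
  Being zero on the other side, it can be summed over all items.\<close>

definition share :: "nat \<Rightarrow> real \<Rightarrow> (nat \<Rightarrow> real) \<Rightarrow> nat \<Rightarrow> real" where
  "share \<sigma> v c i = (if x i = \<sigma> then min 0 (c i - v) else 0)"

text \<open>In the linear programming dual, \<open>v\<^sub>0\<close> is the multiplier of the
  cardinality constraint and \<open>v\<^sub>1 - v\<^sub>0\<close> that of the recovery constraint;
  \<open>p * v\<^sub>0 + (p - k) * (v\<^sub>1 - v\<^sub>0)\<close> rearranges to the first two
  terms.\<close>

definition dual :: "(nat \<Rightarrow> real) \<Rightarrow> real \<Rightarrow> real \<Rightarrow> real" where
  "dual c v\<^sub>1 v\<^sub>0 = real (p - k) * v\<^sub>1 + real k * v\<^sub>0 +
     (\<Sum>i\<in>{1..n}. share 1 v\<^sub>1 c i) + (\<Sum>i\<in>{1..n}. share 0 v\<^sub>0 c i)"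

text \<open>The last summand is the multiplier of the recovery constraint times its slack: weak
  duality uses its sign, strong duality its vanishing.\<close>

lemma threshold_sum:
  assumes "y \<in> sel_rec n p k x"
  shows "(\<Sum>i\<in>{1..n}. (if x i = 1 then v\<^sub>1 else v\<^sub>0) * real (y i)) =
    real (p - k) * v\<^sub>1 + real k * v\<^sub>0 + (v\<^sub>1 - v\<^sub>0) * (real (\<Sum>i\<in>{1..n}. x i * y i) - real (p - k))"
proof -
  have "(\<Sum>i\<in>{1..n}. (if x i = 1 then v\<^sub>1 else v\<^sub>0) * real (y i)) =
      (\<Sum>i\<in>{1..n}. v\<^sub>0 * real (y i) + (v\<^sub>1 - v\<^sub>0) * real (x i * y i))"
    by (rule sum.cong) (use x_cases in \<open>fastforce simp: algebra_simps\<close>)+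
  also have "\<dots> = v\<^sub>0 * real (\<Sum>i\<in>{1..n}. y i) + (v\<^sub>1 - v\<^sub>0) * real (\<Sum>i\<in>{1..n}. x i * y i)"
    by (simp add: sum.distrib sum_distrib_left)
  also have "(\<Sum>i\<in>{1..n}. y i) = p"
    using assms unfolding sel_rec_def by simp
  finally show ?thesis
    using k_le by (simp add: of_nat_diff algebra_simps)
qed

text \<open>Weak duality, item by item: a chosen item pays at least
  \<open>v + min 0 (c i - v)\<close> for the threshold \<open>v\<close> of its side, an unchosen one
  at least \<open>min 0 (c i - v)\<close>. The slack term is nonnegative because
  \<open>v\<^sub>0 \<le> v\<^sub>1\<close>.\<close>

lemma dual_le_cost:
  assumes y: "y \<in> sel_rec n p k x" and v: "v\<^sub>0 \<le> v\<^sub>1"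
  shows "dual c v\<^sub>1 v\<^sub>0 \<le> cost n c y"
proof -
  have "(\<Sum>i\<in>{1..n}. (if x i = 1 then v\<^sub>1 else v\<^sub>0) * real (y i) + share 1 v\<^sub>1 c i + share 0 v\<^sub>0 c i)
      \<le> cost n c y"
    unfolding cost_def
  proof (rule sum_mono)
    fix i assume "i \<in> {1..n}"
    then show "(if x i = 1 then v\<^sub>1 else v\<^sub>0) * real (y i) + share 1 v\<^sub>1 c i + share 0 v\<^sub>0 c i
        \<le> c i * real (y i)"
      using x_cases[of i] y_cases[OF y, of i] by (auto simp: share_def)
  qed
  moreover have "real (\<Sum>i\<in>{1..n}. x i * y i) \<ge> real (p - k)"
    using y unfolding sel_rec_def by (intro of_nat_mono) simp
  then have "0 \<le> (v\<^sub>1 - v\<^sub>0) * (real (\<Sum>i\<in>{1..n}. x i * y i) - real (p - k))"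
    using v by (intro mult_nonneg_nonneg) simp_all
  ultimately show ?thesis
    unfolding sum.distrib threshold_sum[OF y] dual_def by linarith
qed

text \<open>Complementary slackness: \<open>below\<close> and \<open>above\<close> turn the itemwise
  estimates of weak duality into equations, and \<open>tight\<close> removes the slack term.\<close>

lemma dual_eq_cost:
  assumes y: "y \<in> sel_rec n p k x"
    and tight: "v\<^sub>1 = v\<^sub>0 \<or> (\<Sum>i\<in>{1..n}. x i * y i) = p - k"
    and below: "\<And>i. i \<in> {1..n} \<Longrightarrow> y i = 1 \<Longrightarrow> c i \<le> (if x i = 1 then v\<^sub>1 else v\<^sub>0)"
    and above: "\<And>i. i \<in> {1..n} \<Longrightarrow> y i = 0 \<Longrightarrow> (if x i = 1 then v\<^sub>1 else v\<^sub>0) \<le> c i"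
  shows "dual c v\<^sub>1 v\<^sub>0 = cost n c y"
proof -
  have "cost n c y =
      (\<Sum>i\<in>{1..n}. (if x i = 1 then v\<^sub>1 else v\<^sub>0) * real (y i) + share 1 v\<^sub>1 c i + share 0 v\<^sub>0 c i)"
    unfolding cost_def
  proof (rule sum.cong[OF refl])
    fix i assume "i \<in> {1..n}"
    then show "c i * real (y i) =
        (if x i = 1 then v\<^sub>1 else v\<^sub>0) * real (y i) + share 1 v\<^sub>1 c i + share 0 v\<^sub>0 c i"
      using x_cases[of i] y_cases[OF y, of i] below[of i] above[of i] by (auto simp: share_def)
  qed
  moreover have "(v\<^sub>1 - v\<^sub>0) * (real (\<Sum>i\<in>{1..n}. x i * y i) - real (p - k)) = 0"
    using tight by (metis diff_self mult_eq_0_iff)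
  ultimately show ?thesis
    unfolding sum.distrib threshold_sum[OF y] dual_def by linarith
qed

text \<open>Replacing \<open>i\<close> by \<open>l\<close> keeps the cardinality and lowers the
  overlap with \<open>x\<close> by at most one. It does so only if \<open>x i = 1\<close> and
  \<open>x l = 0\<close>, when \<open>feas\<close> provides a spare unit of overlap.\<close>

lemma optimal_exchange:
  assumes y: "y \<in> sel_rec n p k x" and opt: "\<And>z. z \<in> sel_rec n p k x \<Longrightarrow> cost n c y \<le> cost n c z"
    and il: "i \<in> {1..n}" "l \<in> {1..n}" "y i = 1" "y l = 0"
    and feas: "x i \<le> x l \<or> p - k < (\<Sum>i\<in>{1..n}. x i * y i)"
  shows "c i \<le> c l"
proof -
  let ?z = "y(i := 0, l := 1)"
  have "(\<Sum>j\<in>{1..n}. ?z j) = p"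
    using sum_swap[of "{1..n}" i l y "\<lambda>_. 1::nat"] il y unfolding sel_rec_def by simp
  moreover have "(\<Sum>j\<in>{1..n}. x j * ?z j) + x i = (\<Sum>j\<in>{1..n}. x j * y j) + x l"
    using sum_swap[of "{1..n}" i l y x] il by (simp only: of_nat_id finite_atLeastAtMost)
  then have "p - k \<le> (\<Sum>j\<in>{1..n}. x j * ?z j)"
    using feas x_cases[OF il(1)] y unfolding sel_rec_def mem_Collect_eq by linarith
  moreover have "?z \<in> {1..n} \<rightarrow>\<^sub>E {0, 1}"
    using y il unfolding sel_rec_def by (auto simp: PiE_iff extensional_def)
  ultimately have "?z \<in> sel_rec n p k x"
    unfolding sel_rec_def by simp
  then have "cost n c y \<le> cost n c ?z"
    by (rule opt)
  moreover have "cost n c ?z + c i = cost n c y + c l"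
    unfolding cost_def using il by (intro sum_swap) auto
  ultimately show ?thesis
    by simp
qed

text \<open>Take an optimal solution, the threshold \<open>v\<^sub>1\<close> to be its largest cost, and \<open>v\<^sub>0\<close> to be its largest cost
  outside \<open>x\<close> if the recovery constraint is tight, and \<open>v\<^sub>1\<close> otherwise; exchanges show that unchosen
  items are not cheaper than the threshold of their side. If nothing is chosen outside \<open>x\<close>, any small
  enough \<open>v\<^sub>0\<close> works.\<close>

lemma rec_cost_eq_dual:
  obtains i j where "i \<in> {1..n}" "j \<in> {1..n}" "c j \<le> c i" "rec_cost n p k x c = dual c (c i) (c j)"
proof -
  have "rec_cost n p k x c \<in> cost n c ` sel_rec n p k x"
    unfolding rec_cost_def using finite_sel_rec sel_rec_nonempty instance_ok
    by (intro Min_in) (auto simp: arec_instance_def)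
  then obtain y where y: "y \<in> sel_rec n p k x" and val: "rec_cost n p k x c = cost n c y"
    by blast
  have opt: "cost n c y \<le> cost n c z" if "z \<in> sel_rec n p k x" for z
    using that finite_sel_rec unfolding val[symmetric] rec_cost_def by (intro Min_le) auto
  note exch = optimal_exchange[OF y opt]
  define A where "A = {i \<in> {1..n}. y i = 1}"
  define B where "B = {i \<in> A. x i = 0}"
  have "A \<noteq> {}"
  proof
    assume "A = {}"
    then have "y i = 0" if "i \<in> {1..n}" for i
      using y_cases[OF y that] that unfolding A_def by blast
    then show False
      using y p_pos unfolding sel_rec_def by simp
  qed
  moreover have fin: "finite A" "finite B"
    unfolding A_def B_def by auto
  ultimately obtain i where i: "i \<in> A" "\<And>a. a \<in> A \<Longrightarrow> c a \<le> c i"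
    using fin finite_arg_max by blast
  show ?thesis
  proof (cases "p - k < (\<Sum>i\<in>{1..n}. x i * y i)")
    case True
    \<comment> \<open>With slack in the recovery constraint every exchange is feasible, so a single
      threshold serves both sides.\<close>
    have "dual c (c i) (c i) = cost n c y"
      by (rule dual_eq_cost[OF y]) (use i exch[of i] True in \<open>auto simp: A_def\<close>)
    then show ?thesis
      using that[of i i] i val by (auto simp: A_def)
  next
    case False
    then have tight: "(\<Sum>i\<in>{1..n}. x i * y i) = p - k"
      using y unfolding sel_rec_def by simp
    show ?thesis
    proof (cases "B = {}")
      case True
      have "{1..n} \<noteq> {}"
        using n_pos by simp
      \<comment> \<open>The global minimum is the cost of an item, lies below all unchosen costs and
        does not exceed \<open>c i\<close>.\<close>
      then obtain j where j: "j \<in> {1..n}" "\<And>a. a \<in> {1..n} \<Longrightarrow> c j \<le> c a"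
        using finite_arg_min by blast
      have xi: "x a = 1" if "a \<in> A" for a
        using True that x_cases[of a] by (auto simp: B_def A_def)
      have "dual c (c i) (c j) = cost n c y"
        by (rule dual_eq_cost[OF y])
          (use i j xi exch[of i] tight in \<open>auto simp: A_def\<close>)
      then show ?thesis
        using that[of i j] i j val by (auto simp: A_def)
    next
      case False
      then obtain j where j: "j \<in> B" "\<And>a. a \<in> B \<Longrightarrow> c a \<le> c j"
        using fin finite_arg_max by blast
      have "dual c (c i) (c j) = cost n c y"
      proof (rule dual_eq_cost[OF y])
        fix l assume l: "l \<in> {1..n}" "y l = 0"
        \<comment> \<open>The most expensive chosen item may lie outside \<open>x\<close>, but
          exchanging it for an item of \<open>x\<close> never lowers the overlap.\<close>
        have "c i \<le> c l" if "x l = 1"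
          using exch[of i l] i l that x_cases[of i] by (auto simp: A_def)
        moreover have "c j \<le> c l" if "x l \<noteq> 1"
          using exch[of j l] j l by (auto simp: A_def B_def)
        ultimately show "(if x l = 1 then c i else c j) \<le> c l"
          by simp
      next
        fix l assume "l \<in> {1..n}" "y l = 1"
        then show "c l \<le> (if x l = 1 then c i else c j)"
          using i(2)[of l] j(2)[of l] x_cases[of l] by (auto simp: A_def B_def)
      qed (use tight in simp)
      then show ?thesis
        using that[of i j] i j val by (auto simp: A_def B_def)
    qed
  qed
qed

end

section \<open>Weakest preconditions with running time\<close>

lemma nats_nat_upd [simp]: "nats (nat_upd a i v s) b j = (if b = a \<and> j = i then v else nats s b j)"
  and nats_real_upd [simp]: "nats (real_upd a i w s) = nats s"
  and reals_nat_upd [simp]: "reals (nat_upd a i v s) = reals s"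
  and reals_real_upd [simp]: "reals (real_upd a i w s) b j = (if b = a \<and> j = i then w else reals s b j)"
  by (auto simp: nat_upd_def real_upd_def)

text \<open>The postcondition also takes the number of steps; since programs are deterministic, this is a
  total correctness statement.\<close>

definition wp :: "com \<Rightarrow> (nat \<Rightarrow> state \<Rightarrow> bool) \<Rightarrow> state \<Rightarrow> bool" where
  "wp c Q s \<longleftrightarrow> (\<exists>t s'. exec c s t s' \<and> Q t s')"

lemma wp_mono: "wp c R s \<Longrightarrow> (\<And>t s'. R t s' \<Longrightarrow> Q t s') \<Longrightarrow> wp c Q s"
  unfolding wp_def by blast

text \<open>Determinism makes the run unique, which is why the rules for basic commands are
  equivalences and can be used for rewriting.\<close>

lemma wp_exec: "exec c s t s' \<Longrightarrow> wp c Q s \<longleftrightarrow> Q t s'"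
  unfolding wp_def by (metis exec_deterministic)

lemma wp_Skip [simp]: "wp Skip Q s \<longleftrightarrow> Q 1 s"
  by (rule wp_exec[OF exec.Skip])

lemma wp_NAssign [simp]:
  "wp (NAssign a i e) Q s \<longleftrightarrow> Q (1 + ncost i + ncost e) (nat_upd a (nval i s) (nval e s) s)"
  by (rule wp_exec[OF exec.NAssign])

lemma wp_RAssign [simp]:
  "wp (RAssign a i e) Q s \<longleftrightarrow> Q (1 + ncost i + rcost e) (real_upd a (nval i s) (rval e s) s)"
  by (rule wp_exec[OF exec.RAssign])

lemma wp_Seq [simp]: "wp (Seq c d) Q s \<longleftrightarrow> wp c (\<lambda>t s'. wp d (\<lambda>u. Q (t + u)) s') s"
  unfolding wp_def by (blast intro: exec.Seq elim: SeqE)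

lemma wp_Cond [simp]:
  "wp (Cond b c d) Q s \<longleftrightarrow>
     (if bval b s then wp c (\<lambda>t. Q (1 + bcost b + t)) s else wp d (\<lambda>t. Q (1 + bcost b + t)) s)"
  unfolding wp_def
  by (auto intro: exec.CondTrue[simplified] exec.CondFalse[simplified] elim!: CondE)

fun nwrites :: "com \<Rightarrow> vname set" where
  "nwrites (NAssign a i e) = {a}"
| "nwrites (Seq c d) = nwrites c \<union> nwrites d"
| "nwrites (Cond b c d) = nwrites c \<union> nwrites d"
| "nwrites (While b c) = nwrites c"
| "nwrites _ = {}"

fun rwrites :: "com \<Rightarrow> vname set" where
  "rwrites (RAssign a i e) = {a}"
| "rwrites (Seq c d) = rwrites c \<union> rwrites d"
| "rwrites (Cond b c d) = rwrites c \<union> rwrites d"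
| "rwrites (While b c) = rwrites c"
| "rwrites _ = {}"

lemma exec_frame:
  assumes "exec c s t s'"
  shows "a \<notin> nwrites c \<Longrightarrow> nats s' a = nats s a" and "a \<notin> rwrites c \<Longrightarrow> reals s' a = reals s a"
  using assms by (induction rule: exec.induct) (auto simp: nat_upd_def real_upd_def)

text \<open>Specifications can stay silent about arrays that a program never writes. This carries
  the first table past the filling of the second, and the search result past the traces.\<close>

lemma wp_frame:
  assumes "wp c R s"
    and "\<And>t s'. R t s' \<Longrightarrow> (\<And>a. a \<notin> nwrites c \<Longrightarrow> nats s' a = nats s a) \<Longrightarrow>
      (\<And>a. a \<notin> rwrites c \<Longrightarrow> reals s' a = reals s a) \<Longrightarrow> Q t s'"
  shows "wp c Q s"
  using assms exec_frame unfolding wp_def by metis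

abbreviation NVar :: "vname \<Rightarrow> nexp" where
  "NVar a \<equiv> NCell a (NConst 0)"

abbreviation RVar :: "vname \<Rightarrow> rexp" where
  "RVar a \<equiv> RCell a (NConst 0)"

definition For :: "vname \<Rightarrow> nexp \<Rightarrow> com \<Rightarrow> com" where
  "For a e c = Seq (NAssign a (NConst 0) (NConst 0))
     (While (NLess (NVar a) e) (Seq c (NAssign a (NConst 0) (NAdd (NVar a) (NConst 1)))))"

lemma nwrites_For [simp]: "nwrites (For a e c) = insert a (nwrites c)"
  and rwrites_For [simp]: "rwrites (For a e c) = rwrites c"
  by (auto simp: For_def)

text \<open>The invariant \<open>I i\<close> describes the state once the counter shows
  \<open>i\<close>, hence the update to \<open>Suc i\<close> in \<open>step\<close>. Setting the
  counter costs 3, each test \<open>4 + ncost e\<close> and each increment 6, which gives the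
  constants.\<close>

lemma wp_For:
  assumes init: "I 0 (nat_upd a 0 0 s)"
    and bound: "\<And>i s. I i s \<Longrightarrow> nval e s = m"
    and step: "\<And>i s. i < m \<Longrightarrow> nats s a 0 = i \<Longrightarrow> I i s \<Longrightarrow>
      wp c (\<lambda>t s'. t \<le> \<tau> \<and> nats s' a 0 = i \<and> I (Suc i) (nat_upd a 0 (Suc i) s')) s"
    and final: "\<And>t s'. t \<le> 7 + ncost e + m * (\<tau> + 10 + ncost e) \<Longrightarrow> I m s' \<Longrightarrow> Q t s'"
  shows "wp (For a e c) Q s"
proof -
  define b where "b = NLess (NVar a) e"
  define d where "d = Seq c (NAssign a (NConst 0) (NAdd (NVar a) (NConst 1)))"
  have loop: "\<exists>t s'. exec (While b d) s t s' \<and> t \<le> 4 + ncost e + (m - i) * (\<tau> + 10 + ncost e) \<and> I m s'"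
    if "i \<le> m" "I i s" "nats s a 0 = i" for i s
    using that
  proof (induction "m - i" arbitrary: i s)
    case 0
    then have "i = m"
      by simp
    then have "\<not> bval b s"
      using bound[OF \<open>I i s\<close>] \<open>nats s a 0 = i\<close> by (simp add: b_def)
    then show ?case
      using exec.WhileFalse[of b s d] \<open>I i s\<close> \<open>i = m\<close> by (fastforce simp: b_def)
  next
    case (Suc l)
    then have i: "i < m"
      by simp
    obtain t s1 where s1: "exec c s t s1" "t \<le> \<tau>" "nats s1 a 0 = i"
        "I (Suc i) (nat_upd a 0 (Suc i) s1)"
      using step[OF i \<open>nats s a 0 = i\<close> \<open>I i s\<close>] unfolding wp_def by blast
    have "bval b s"
      using bound[OF \<open>I i s\<close>] \<open>nats s a 0 = i\<close> i by (simp add: b_def)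
    moreover have "exec d s (t + 6) (nat_upd a 0 (Suc i) s1)"
      unfolding d_def
      using exec.Seq[OF s1(1) exec.NAssign[of a "NConst 0" "NAdd (NVar a) (NConst 1)"]] s1(3)
      by (simp add: numeral_eq_Suc)
    moreover obtain u s2 where s2: "exec (While b d) (nat_upd a 0 (Suc i) s1) u s2"
        "u \<le> 4 + ncost e + (m - Suc i) * (\<tau> + 10 + ncost e)" "I m s2"
      using Suc.hyps(1)[OF _ _ s1(4)] Suc.hyps(2) i by fastforce
    ultimately have "exec (While b d) s (1 + bcost b + (t + 6) + u) s2"
      using exec.WhileTrue by blast
    moreover have "(m - i) * (\<tau> + 10 + ncost e) =
        (\<tau> + 10 + ncost e) + (m - Suc i) * (\<tau> + 10 + ncost e)"
      using i by (metis Suc_diff_Suc mult_Suc)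
    then have "1 + bcost b + (t + 6) + u \<le> 4 + ncost e + (m - i) * (\<tau> + 10 + ncost e)"
      using s1(2) s2(2) by (simp add: b_def)
    ultimately show ?case
      using s2(3) by blast
  qed
  obtain t s' where t: "exec (While b d) (nat_upd a 0 0 s) t s'" "I m s'"
      "t \<le> 4 + ncost e + m * (\<tau> + 10 + ncost e)"
    using loop[OF _ init] by auto
  have "exec (For a e c) s (3 + t) s'"
    unfolding For_def b_def[symmetric] d_def[symmetric]
    using exec.Seq[OF exec.NAssign[of a "NConst 0" "NConst 0" s]] t(1) by (simp add: numeral_3_eq_3)
  moreover have "Q (3 + t) s'"
    using t by (intro final) auto
  ultimately show ?thesis
    unfolding wp_def by blast
qed

section \<open>The dynamic program\<close>

text \<open>The numbers \<open>u i\<close> and \<open>r i\<close> are the contributions of item \<open>i\<close> at its lower and at its raised cost.\<close>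

fun best :: "(nat \<Rightarrow> real) \<Rightarrow> (nat \<Rightarrow> real) \<Rightarrow> nat \<Rightarrow> nat \<Rightarrow> real" where
  "best u r 0 g = 0"
| "best u r (Suc i) g =
     (if g = 0 then best u r i 0 + u (Suc i)
      else max (best u r i g + u (Suc i)) (best u r i (g - 1) + r (Suc i)))"

text \<open>Removing the last item from \<open>R\<close> frees one unit of budget exactly if it was
  raised, which matches the two branches of the recurrence. That the bound is attained is shown
  later, by tracing back.\<close>

lemma sum_le_best:
  "R \<subseteq> {1..i} \<Longrightarrow> card R \<le> g \<Longrightarrow> (\<Sum>j\<in>{1..i}. if j \<in> R then r j else u j) \<le> best u r i g"
proof (induction i arbitrary: R g)
  case (Suc i)
  let ?R = "R - {Suc i}"
  have fin: "finite R"
    using Suc.prems(1) finite_subset by blast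
  have sub: "?R \<subseteq> {1..i}"
    using Suc.prems(1) by (auto simp: le_Suc_eq)
  have "(\<Sum>j\<in>{1..i}. if j \<in> R then r j else u j) = (\<Sum>j\<in>{1..i}. if j \<in> ?R then r j else u j)"
    by (rule sum.cong) auto
  moreover have "(\<Sum>j\<in>{1..i}. if j \<in> ?R then r j else u j) \<le> best u r i (if Suc i \<in> R then g - 1 else g)"
    using Suc.prems(2) fin by (intro Suc.IH sub) (auto simp: card_Diff_singleton)
  moreover have "g \<noteq> 0" if "Suc i \<in> R"
    using that Suc.prems(2) fin by (metis card_0_eq empty_iff le_zero_eq)
  ultimately show ?case
    by (auto split: if_splits)
qed simp

section \<open>Programs for the phases of the algorithm\<close>

text \<open>Reals cannot be converted to naturals, so \<Gamma> is rounded down by counting. Counting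
  stops at \<open>n\<close>, since no more items can be raised.\<close>

definition budget_prog :: com where
  "budget_prog = Seq (NAssign ''G'' (NConst 0) (NConst 0))
     (For ''i'' (NVar ''n'')
       (Cond (RLess (RVar ''Gamma'') (ROfNat (NAdd (NVar ''G'') (NConst 1)))) Skip
         (NAssign ''G'' (NConst 0) (NAdd (NVar ''G'') (NConst 1)))))"

text \<open>One array lists all \<open>2 * n\<close> candidate thresholds, with \<open>lo\<close> at
  even and \<open>hi\<close> at odd positions; the shift by one is due to items starting at 1.
  \<open>N\<close> is \<open>n + 1\<close> because both the item index and the budget of a table
  entry run from 0 to \<open>n\<close>.\<close>

definition threshold_prog :: com where
  "threshold_prog = Seq (NAssign ''N'' (NConst 0) (NAdd (NVar ''n'') (NConst 1)))
     (For ''i'' (NVar ''n'')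
       (Seq (RAssign ''v'' (NMul (NConst 2) (NVar ''i'')) (RCell ''lo'' (NAdd (NVar ''i'') (NConst 1))))
         (RAssign ''v'' (NAdd (NMul (NConst 2) (NVar ''i'')) (NConst 1))
           (RCell ''hi'' (NAdd (NVar ''i'') (NConst 1))))))"

definition share_prog :: "nat \<Rightarrow> vname \<Rightarrow> vname \<Rightarrow> com" where
  "share_prog \<sigma> a w =
     Cond (BAnd (NEq (NCell ''x'' (NVar ''i'')) (NConst \<sigma>))
         (RLess (RCell a (NVar ''i'')) (RCell ''v'' (NVar ''b''))))
       (RAssign w (NConst 0) (RSub (RCell a (NVar ''i'')) (RCell ''v'' (NVar ''b''))))
       (RAssign w (NConst 0) (ROfNat (NConst 0)))"

definition cell :: "nexp \<Rightarrow> nexp \<Rightarrow> nexp \<Rightarrow> nexp" where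
  "cell b i g = NAdd (NMul (NAdd (NMul b (NVar ''N'')) i) (NVar ''N'')) g"

lemma ncost_cell [simp]: "ncost (cell b i g) = 8 + ncost b + ncost i + ncost g"
  by (simp add: cell_def)

lemma nval_cell [simp]:
  "nval (cell b i g) s = (nval b s * nats s ''N'' 0 + nval i s) * nats s ''N'' 0 + nval g s"
  by (simp add: cell_def)

text \<open>Going back by \<open>N\<close> leads to the previous item with the same budget, going
  back by \<open>N + 1\<close> also lowers the budget by one.\<close>

abbreviation prev_cell :: nexp where
  "prev_cell \<equiv> NSub (NVar ''m'') (NVar ''N'')"

abbreviation diag_cell :: nexp where
  "diag_cell \<equiv> NSub (NVar ''m'') (NAdd (NVar ''N'') (NConst 1))"

definition entry_prog :: "nat \<Rightarrow> vname \<Rightarrow> com" where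
  "entry_prog \<sigma> T =
     Seq (NAssign ''m'' (NConst 0) (cell (NVar ''b'') (NVar ''i'') (NVar ''g'')))
     (Cond (NEq (NVar ''i'') (NConst 0))
       (RAssign T (NVar ''m'') (ROfNat (NConst 0)))
       (Seq (share_prog \<sigma> ''lo'' ''u'')
       (Seq (share_prog \<sigma> ''hi'' ''r'')
       (Seq (RAssign T (NVar ''m'') (RAdd (RCell T prev_cell) (RVar ''u'')))
       (Cond (BAnd (NLess (NConst 0) (NVar ''g''))
             (RLess (RCell T (NVar ''m'')) (RAdd (RCell T diag_cell) (RVar ''r''))))
         (RAssign T (NVar ''m'') (RAdd (RCell T diag_cell) (RVar ''r'')))
         Skip)))))"

definition table_prog :: "nat \<Rightarrow> vname \<Rightarrow> com" where
  "table_prog \<sigma> T =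
     For ''b'' (NMul (NConst 2) (NVar ''n'')) (For ''i'' (NVar ''N'') (For ''g'' (NVar ''N'')
       (entry_prog \<sigma> T)))"

definition candidate :: "vname \<Rightarrow> vname \<Rightarrow> vname \<Rightarrow> rexp" where
  "candidate a b h =
     RAdd (RAdd (RMul (ROfNat (NSub (NVar ''p'') (NVar ''k''))) (RCell ''v'' (NVar a)))
           (RMul (ROfNat (NVar ''k'')) (RCell ''v'' (NVar b))))
       (RAdd (RCell ''T1'' (cell (NVar a) (NVar ''n'') (NVar h)))
         (RCell ''T0'' (cell (NVar b) (NVar ''n'') (NSub (NVar ''G'') (NVar h)))))"

text \<open>The initial triple is admissible because its two thresholds coincide, so
  \<open>value\<close> is the bound of an admissible triple from the start.\<close>

definition search_prog :: com where
  "search_prog =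
     Seq (NAssign ''A'' (NConst 0) (NConst 0))
     (Seq (NAssign ''B'' (NConst 0) (NConst 0))
     (Seq (NAssign ''H'' (NConst 0) (NConst 0))
     (Seq (RAssign ''value'' (NConst 0) (candidate ''A'' ''B'' ''H''))
     (For ''a'' (NMul (NConst 2) (NVar ''n'')) (For ''b'' (NMul (NConst 2) (NVar ''n''))
       (For ''h'' (NAdd (NVar ''G'') (NConst 1))
         (Cond (BAnd (BNot (RLess (RCell ''v'' (NVar ''a'')) (RCell ''v'' (NVar ''b''))))
               (RLess (RVar ''value'') (candidate ''a'' ''b'' ''h'')))
           (Seq (NAssign ''A'' (NConst 0) (NVar ''a''))
           (Seq (NAssign ''B'' (NConst 0) (NVar ''b''))
           (Seq (NAssign ''H'' (NConst 0) (NVar ''h''))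
             (RAssign ''value'' (NConst 0) (candidate ''a'' ''b'' ''h'')))))
           Skip)))))))"

text \<open>An item that is raised on the wrong side \<open>x i \<noteq> \<sigma>\<close> wastes budget without effect, so the trace need
  not avoid it: it only leaves the output cell of such an item alone.\<close>

definition trace_prog :: "nat \<Rightarrow> vname \<Rightarrow> vname \<Rightarrow> nexp \<Rightarrow> com" where
  "trace_prog \<sigma> T B h =
     Seq (NAssign ''b'' (NConst 0) (NVar B))
     (Seq (NAssign ''g'' (NConst 0) h)
     (For ''j'' (NVar ''n'')
       (Seq (NAssign ''i'' (NConst 0) (NSub (NVar ''n'') (NVar ''j'')))
       (Seq (NAssign ''m'' (NConst 0) (cell (NVar ''b'') (NVar ''i'') (NVar ''g'')))
       (Seq (share_prog \<sigma> ''hi'' ''r'')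
         (Cond (BAnd (NLess (NConst 0) (NVar ''g''))
               (REq (RCell T (NVar ''m'')) (RAdd (RCell T diag_cell) (RVar ''r''))))
           (Seq (NAssign ''g'' (NConst 0) (NSub (NVar ''g'') (NConst 1)))
             (Cond (NEq (NCell ''x'' (NVar ''i'')) (NConst \<sigma>))
               (RAssign ''c'' (NVar ''i'') (RCell ''hi'' (NVar ''i''))) Skip))
           (Cond (NEq (NCell ''x'' (NVar ''i'')) (NConst \<sigma>))
             (RAssign ''c'' (NVar ''i'') (RCell ''lo'' (NVar ''i''))) Skip)))))))"

definition arec_prog :: com where
  "arec_prog = Seq budget_prog (Seq threshold_prog (Seq (table_prog 1 ''T1'') (Seq (table_prog 0 ''T0'')
     (Seq search_prog (Seq (trace_prog 1 ''T1'' ''A'' (NVar ''H''))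
       (trace_prog 0 ''T0'' ''B'' (NSub (NVar ''G'') (NVar ''H''))))))))"

section \<open>Computed quantities and predicates on states\<close>

context arec
begin

abbreviation input :: "state \<Rightarrow> bool" where
  "input \<equiv> arec_input n p k x lo hi \<Gamma>"

text \<open>The cap at \<open>n\<close> keeps the tables quadratic per threshold and the number of
  budget splittings linear, however large \<Gamma> is.\<close>

definition budget :: nat where
  "budget = min n (nat \<lfloor>\<Gamma>\<rfloor>)"

definition thr :: "nat \<Rightarrow> real" where
  "thr b = (if even b then lo (Suc (b div 2)) else hi (Suc (b div 2)))"

definition opt :: "nat \<Rightarrow> nat \<Rightarrow> nat \<Rightarrow> nat \<Rightarrow> real" where
  "opt \<sigma> b = best (share \<sigma> (thr b) lo) (share \<sigma> (thr b) hi)"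

definition ready :: "state \<Rightarrow> bool" where
  "ready s \<longleftrightarrow> input s \<and> nats s ''G'' 0 = budget \<and> nats s ''N'' 0 = Suc n \<and>
     (\<forall>b<2 * n. reals s ''v'' b = thr b)"

abbreviation idx :: "nat \<Rightarrow> nat \<Rightarrow> nat \<Rightarrow> nat" where
  "idx b i g \<equiv> (b * Suc n + i) * Suc n + g"

text \<open>Tables are stored linearly in the order in which they are filled, at the positions \<open>idx b i g\<close>,
  so a partially filled table is described by the number of its entries alone.\<close>

definition filled :: "nat \<Rightarrow> vname \<Rightarrow> nat \<Rightarrow> state \<Rightarrow> bool" where
  "filled \<sigma> T m s \<longleftrightarrow>
     (\<forall>q<m. reals s T q = opt \<sigma> (q div Suc n div Suc n) (q div Suc n mod Suc n) (q mod Suc n))"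

lemma input_nat_upd [simp]:
  "''n'' \<noteq> a \<Longrightarrow> ''p'' \<noteq> a \<Longrightarrow> ''k'' \<noteq> a \<Longrightarrow> ''x'' \<noteq> a \<Longrightarrow>
     input (nat_upd a i v s) = input s"
  by (simp add: arec_input_def)

lemma input_real_upd [simp]:
  "''Gamma'' \<noteq> a \<Longrightarrow> ''lo'' \<noteq> a \<Longrightarrow> ''hi'' \<noteq> a \<Longrightarrow>
     input (real_upd a i w s) = input s"
  by (simp add: arec_input_def)

lemma ready_nat_upd [simp]:
  "''n'' \<noteq> a \<Longrightarrow> ''p'' \<noteq> a \<Longrightarrow> ''k'' \<noteq> a \<Longrightarrow> ''x'' \<noteq> a \<Longrightarrow> ''G'' \<noteq> a \<Longrightarrow> ''N'' \<noteq> a \<Longrightarrow>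
     ready (nat_upd a i v s) = ready s"
  by (simp add: ready_def)

lemma ready_real_upd [simp]:
  "''Gamma'' \<noteq> a \<Longrightarrow> ''lo'' \<noteq> a \<Longrightarrow> ''hi'' \<noteq> a \<Longrightarrow> ''v'' \<noteq> a \<Longrightarrow>
     ready (real_upd a i w s) = ready s"
  by (simp add: ready_def)

lemma input_simps:
  assumes "input s"
  shows "nats s ''n'' 0 = n" "nats s ''p'' 0 = p" "nats s ''k'' 0 = k" "reals s ''Gamma'' 0 = \<Gamma>"
    "\<And>i. 0 < i \<Longrightarrow> i \<le> n \<Longrightarrow> nats s ''x'' i = x i"
    "\<And>i. 0 < i \<Longrightarrow> i \<le> n \<Longrightarrow> reals s ''lo'' i = lo i"
    "\<And>i. 0 < i \<Longrightarrow> i \<le> n \<Longrightarrow> reals s ''hi'' i = hi i"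
  using assms unfolding arec_input_def by auto

lemma ready_simps:
  assumes "ready s"
  shows "nats s ''n'' 0 = n" "nats s ''p'' 0 = p" "nats s ''k'' 0 = k" "reals s ''Gamma'' 0 = \<Gamma>"
    "nats s ''G'' 0 = budget" "nats s ''N'' 0 = Suc n"
    "\<And>i. 0 < i \<Longrightarrow> i \<le> n \<Longrightarrow> nats s ''x'' i = x i"
    "\<And>i. 0 < i \<Longrightarrow> i \<le> n \<Longrightarrow> reals s ''lo'' i = lo i"
    "\<And>i. 0 < i \<Longrightarrow> i \<le> n \<Longrightarrow> reals s ''hi'' i = hi i"
    "\<And>b. b < 2 * n \<Longrightarrow> reals s ''v'' b = thr b"
  using assms input_simps[of s] unfolding ready_def by auto

section \<open>Computing the budget and the thresholds\<close>

lemma budget_wp: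
  assumes "input s"
  shows "wp budget_prog (\<lambda>t s'. t \<le> 12 + n * 112 \<and> input s' \<and> nats s' ''G'' 0 = budget) s"
proof -
  \<comment> \<open>The counter either keeps pace with the loop or is stuck at the floor of
    \<Gamma>.\<close>
  define I where "I i s \<longleftrightarrow> input s \<and> nats s ''G'' 0 \<le> i \<and>
    real (nats s ''G'' 0) \<le> \<Gamma> \<and> (nats s ''G'' 0 = i \<or> \<Gamma> < real (nats s ''G'' 0) + 1)" for i s
  show ?thesis
    unfolding budget_prog_def wp_Seq wp_NAssign
  proof (rule wp_For[where I = I and m = n and \<tau> = 100], goal_cases init bound step final)
    case init
    show ?case
      using assms \<Gamma>_nonneg by (simp add: I_def)
  next
    case (bound i s)
    then show ?case
      by (simp add: I_def input_simps)
  next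
    case (step i s)
    then show ?case
      by (auto simp: I_def input_simps)
  next
    case (final t s')
    then show ?case
      by (simp add: budget_def I_def min_def) linarith
  qed
qed

lemma threshold_wp:
  assumes "input s" "nats s ''G'' 0 = budget"
  shows "wp threshold_prog (\<lambda>t s'. t \<le> 16 + n * 112 \<and> ready s') s"
proof -
  define I where "I i s \<longleftrightarrow> input s \<and> nats s ''G'' 0 = budget \<and>
    nats s ''N'' 0 = Suc n \<and> (\<forall>b<2 * i. reals s ''v'' b = thr b)" for i s
  show ?thesis
    unfolding threshold_prog_def wp_Seq wp_NAssign
  proof (rule wp_For[where I = I and m = n and \<tau> = 100], goal_cases init bound step final)
    case init
    show ?case
      using assms by (simp add: I_def input_simps)
  next
    case (bound i s)
    then show ?case
      by (simp add: I_def input_simps)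
  next
    case (step i s)
    have "b < 2 * Suc i \<longleftrightarrow> b < 2 * i \<or> b = 2 * i \<or> b = 2 * i + 1" for b
      by auto
    with step show ?case
      by (simp add: I_def input_simps thr_def)
  next
    case (final t s')
    then show ?case
      by (simp add: I_def ready_def)
  qed
qed

section \<open>Addressing and filling the tables\<close>

abbreviation idx_max :: nat where
  "idx_max \<equiv> 2 * n * Suc n * Suc n"

lemma budget_le: "budget \<le> n"
  by (simp add: budget_def)

lemma idx_le_max:
  assumes "b < 2 * n" "i \<le> n" "g \<le> n"
  shows "idx b i g < idx_max"
proof -
  have "idx b i g \<le> (b * Suc n + n) * Suc n + n"
    using assms by (intro add_mono mult_mono) auto
  also have "\<dots> < Suc b * Suc n * Suc n"
    by (simp add: algebra_simps)
  also have "\<dots> \<le> idx_max"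
    using assms by (intro mult_mono) auto
  finally show ?thesis .
qed

text \<open>Positions are numbers in base \<open>Suc n\<close> with last digits \<open>i\<close> and
  \<open>g\<close>.\<close>

lemma idx_decode:
  assumes "i \<le> n" "g \<le> n"
  shows "idx b i g div Suc n = b * Suc n + i" "idx b i g mod Suc n = g"
    "(b * Suc n + i) div Suc n = b" "(b * Suc n + i) mod Suc n = i"
  using assms by (simp_all only: div_mult_self3 div_mult_self4 mod_mult_self3 mod_mult_self4 div_less mod_less
      less_Suc_eq_le add_0_right nat.distinct simp_thms)

lemma filled_nat_upd [simp]: "filled \<sigma> T m (nat_upd a i v s) = filled \<sigma> T m s"
  by (simp add: filled_def)

lemma filled_real_upd [simp]: "T \<noteq> a \<Longrightarrow> filled \<sigma> T m (real_upd a i w s) = filled \<sigma> T m s"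
  by (simp add: filled_def)

lemma filled_at:
  assumes "filled \<sigma> T m s" "idx b i g < m" "i \<le> n" "g \<le> n"
  shows "reals s T (idx b i g) = opt \<sigma> b i g"
  using assms idx_decode[OF assms(3,4), of b] unfolding filled_def by metis

lemma filled_Suc:
  assumes "filled \<sigma> T (idx b i g) s" "i \<le> n" "g \<le> n" "w = opt \<sigma> b i g"
  shows "filled \<sigma> T (Suc (idx b i g)) (real_upd T (idx b i g) w s)"
proof -
  have "reals (real_upd T (idx b i g) w s) T q =
      opt \<sigma> (q div Suc n div Suc n) (q div Suc n mod Suc n) (q mod Suc n)"
    if "q < Suc (idx b i g)" for q
  proof (cases "q = idx b i g")
    case True
    show ?thesis
      unfolding True idx_decode[OF assms(2,3)] using assms(4) by simp
  next
    case False
    then have "q < idx b i g"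
      using that by linarith
    with False assms(1) show ?thesis
      unfolding filled_def by simp
  qed
  then show ?thesis
    unfolding filled_def by blast
qed

lemma share_wp:
  assumes "ready s" "nats s ''i'' 0 = i" "0 < i" "i \<le> n" "nats s ''b'' 0 = b" "b < 2 * n"
    and "a = ''lo'' \<and> c = lo \<or> a = ''hi'' \<and> c = hi"
    and Q: "\<And>t. t \<le> 30 \<Longrightarrow> Q t (real_upd w 0 (share \<sigma> (thr b) c i) s)"
  shows "wp (share_prog \<sigma> a w) Q s"
proof -
  have "x i = \<sigma> \<Longrightarrow> c i < thr b \<Longrightarrow> share \<sigma> (thr b) c i = c i - thr b"
    and "\<not> (x i = \<sigma> \<and> c i < thr b) \<Longrightarrow> share \<sigma> (thr b) c i = 0"
    by (auto simp: share_def)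
  with assms show ?thesis
    by (auto simp: share_prog_def ready_simps)
qed

lemma entry_wp:
  assumes s: "ready s" "filled \<sigma> T (idx b i g) s" "nats s ''b'' 0 = b" "nats s ''i'' 0 = i" "nats s ''g'' 0 = g"
    and bnd: "b < 2 * n" "i \<le> n" "g \<le> n" and T: "T = ''T0'' \<or> T = ''T1''"
  shows "wp (entry_prog \<sigma> T) (\<lambda>t s'. t \<le> 200 \<and> ready s' \<and> filled \<sigma> T (Suc (idx b i g)) s' \<and>
    nats s' ''b'' 0 = b \<and> nats s' ''i'' 0 = i \<and> nats s' ''g'' 0 = g) s"
proof -
  have T_neq: "''Gamma'' \<noteq> T" "''lo'' \<noteq> T" "''hi'' \<noteq> T" "''v'' \<noteq> T" "T \<noteq> ''u''" "T \<noteq> ''r''" "''u'' \<noteq> T" "''r'' \<noteq> T"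
    using T by auto
  define q where "q = idx b i g"
  have q: "nval (cell (NVar ''b'') (NVar ''i'') (NVar ''g'')) s = q"
    using s by (simp add: q_def ready_simps)
  have fin: "filled \<sigma> T (Suc q) (real_upd T q w s')" if "filled \<sigma> T q s'" "w = opt \<sigma> b i g" for w s'
    using that bnd filled_Suc unfolding q_def by blast
  show ?thesis
  proof (cases i)
    case 0
    have "filled \<sigma> T q s"
      using s(2) by (simp only: q_def)
    moreover have "opt \<sigma> b i g = 0"
      by (simp add: opt_def 0)
    ultimately show ?thesis
      unfolding q_def[symmetric] entry_prog_def wp_Seq wp_NAssign wp_Cond q
      using s(1,3-5) 0 T_neq by (simp add: fin)
  next
    case (Suc i')
    then have i0: "0 < i" "i \<noteq> 0"
      by simp_all
    \<comment> \<open>Both entries read by the recurrence lie at smaller positions than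
      \<open>q\<close>, hence in the filled part of the table.\<close>
    define q1 where "q1 = idx b i' g"
    define q2 where "q2 = idx b i' (g - 1)"
    have q1: "q - Suc n = q1" "q1 < q"
      by (simp_all add: q_def q1_def Suc)
    have q2: "q - Suc (Suc n) = q2" "q2 < q" if "0 < g"
      using that by (simp_all add: q_def q2_def Suc)
    have T1: "reals s T q1 = opt \<sigma> b i' g"
      unfolding q1_def using s(2) q1 bnd by (intro filled_at) (auto simp: q_def q1_def Suc)
    have T2: "reals s T q2 = opt \<sigma> b i' (g - 1)" if "0 < g"
      unfolding q2_def using s(2) q2[OF that] bnd by (intro filled_at) (auto simp: q_def q2_def Suc)
    have opt_rec: "opt \<sigma> b i g = (if g = 0 then opt \<sigma> b i' g + share \<sigma> (thr b) lo i
        else max (opt \<sigma> b i' g + share \<sigma> (thr b) lo i) (opt \<sigma> b i' (g - 1) + share \<sigma> (thr b) hi i))"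
      by (simp add: opt_def Suc)
    have upd: "filled \<sigma> T q (real_upd T q w s') = filled \<sigma> T q s'" for w s'
      by (simp add: filled_def)
    let ?s = "nat_upd ''m'' (nval (NConst 0) s) q s"
    have fq: "filled \<sigma> T q s"
      using s(2) by (simp only: q_def)
    have neq: "q1 \<noteq> q" "0 < g \<Longrightarrow> q2 \<noteq> q"
      using q1 q2 by auto
    have "\<not> bval (NEq (NVar ''i'') (NConst 0)) ?s"
      using s i0 by simp
    then show ?thesis
      unfolding q_def[symmetric] entry_prog_def wp_Seq wp_NAssign wp_Cond[of "NEq _ _"] q
      apply (simp only: if_False)
      apply (rule share_wp[where i = i and b = b and c = lo]; (simp add: s bnd i0; fail)?)
      apply (rule share_wp[where i = i and b = b and c = hi]; (simp add: s bnd i0; fail)?)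
      apply (cases "g = 0")
      subgoal using s(1,3-5) fq T_neq q1(1) neq T1 opt_rec by (simp add: ready_simps fin)
      subgoal using s(1,3-5) fq T_neq q1(1) q2(1) neq T1 T2 opt_rec by (auto simp: ready_simps upd intro!: fin)
      done
  qed
qed

text \<open>An entry takes at most 200 steps. The loop rule adds 9 per loop and 12 per round for the
  bound \<open>n\<close> or \<open>N\<close>, and 11 and 14 for the bound
  \<open>2 * n\<close>.\<close>

lemma table_wp:
  assumes "ready s" and T: "T = ''T0'' \<or> T = ''T1''"
  shows "wp (table_prog \<sigma> T) (\<lambda>t s'. t \<le> 11 + 2 * n * (9 + Suc n * (9 + Suc n * 212 + 12) + 14) \<and>
    ready s' \<and> filled \<sigma> T idx_max s') s"
  unfolding table_prog_def
proof (rule wp_For[where m = "2 * n" and \<tau> = "9 + Suc n * (9 + Suc n * 212 + 12)" and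
      I = "\<lambda>b s. ready s \<and> filled \<sigma> T (idx b 0 0) s"], goal_cases init bound step final)
  case init
  show ?case
    using assms by (simp add: filled_def)
next
  case (bound b s)
  then show ?case
    by (simp add: ready_simps)
next
  case (step b s)
  note b = \<open>b < 2 * n\<close>
  show ?case
  proof (rule wp_For[where m = "Suc n" and \<tau> = "9 + Suc n * 212" and
        I = "\<lambda>i s. ready s \<and> nats s ''b'' 0 = b \<and> filled \<sigma> T (idx b i 0) s"], goal_cases init bound step final)
    case init
    show ?case
      using step by simp
  next
    case (bound i s)
    then show ?case
      by (simp add: ready_simps)
  next
    case (step i s)
    then have i: "i \<le> n"
      by simp
    show ?case
    proof (rule wp_For[where m = "Suc n" and \<tau> = 200 and
          I = "\<lambda>g s. ready s \<and> nats s ''b'' 0 = b \<and> nats s ''i'' 0 = i \<and> filled \<sigma> T (idx b i g) s"],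
        goal_cases init bound step final)
      case init
      show ?case
        using step by simp
    next
      case (bound g s)
      then show ?case
        by (simp add: ready_simps)
    next
      case (step g s)
      then have "g \<le> n"
        by simp
      show ?case
        by (rule wp_mono[OF entry_wp[where b = b and i = i and g = g]]) (use step b i \<open>g \<le> n\<close> T in auto)
    next
      case (final t s')
      \<comment> \<open>The position just past a row is the start of the next one, so the invariant
        passes from the inner to the outer loop.\<close>
      have "idx b i (Suc n) = idx b (Suc i) 0"
        by simp
      then have "filled \<sigma> T (idx b (Suc i) 0) s'"
        using final by metis
      with final show ?case
        by simp
    qed
  next
    case (final t s')
    have "idx b (Suc n) 0 = idx (Suc b) 0 0"
      by simp
    then have "filled \<sigma> T (idx (Suc b) 0 0) s'"
      using final by metis
    with final show ?case
      by simp
  qed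
next
  case (final t s')
  then show ?case
    by simp
qed

section \<open>Search over thresholds and budget splittings\<close>

text \<open>This is the best dual value for the thresholds \<open>thr a\<close> and
  \<open>thr b\<close> when \<open>h\<close> units of the budget go to the side
  \<open>x i = 1\<close> and the rest to the other side.\<close>

definition bound_at :: "nat \<Rightarrow> nat \<Rightarrow> nat \<Rightarrow> real" where
  "bound_at a b h = real (p - k) * thr a + real k * thr b + (opt 1 a n h + opt 0 b n (budget - h))"

definition tables :: "state \<Rightarrow> bool" where
  "tables s \<longleftrightarrow> ready s \<and> filled 1 ''T1'' idx_max s \<and> filled 0 ''T0'' idx_max s"

lemma tables_nat_upd [simp]:
  "''n'' \<noteq> a \<Longrightarrow> ''p'' \<noteq> a \<Longrightarrow> ''k'' \<noteq> a \<Longrightarrow> ''x'' \<noteq> a \<Longrightarrow> ''G'' \<noteq> a \<Longrightarrow> ''N'' \<noteq> a \<Longrightarrow>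
     tables (nat_upd a i v s) = tables s"
  by (simp add: tables_def)

lemma tables_real_upd [simp]:
  "''Gamma'' \<noteq> a \<Longrightarrow> ''lo'' \<noteq> a \<Longrightarrow> ''hi'' \<noteq> a \<Longrightarrow> ''v'' \<noteq> a \<Longrightarrow> ''T1'' \<noteq> a \<Longrightarrow> ''T0'' \<noteq> a \<Longrightarrow>
     tables (real_upd a i w s) = tables s"
  by (simp add: tables_def)

lemma tables_at:
  assumes "tables s" "b < 2 * n" "i \<le> n" "g \<le> n"
  shows "reals s ''T1'' (idx b i g) = opt 1 b i g" "reals s ''T0'' (idx b i g) = opt 0 b i g"
  using assms idx_le_max[OF assms(2-4)] filled_at unfolding tables_def by blast+

lemma tables_simps:
  assumes "tables s"
  shows "ready s" "nats s ''n'' 0 = n" "nats s ''G'' 0 = budget" "nats s ''N'' 0 = Suc n"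
    "b < 2 * n \<Longrightarrow> reals s ''v'' b = thr b"
  using assms unfolding tables_def by (auto simp: ready_simps)

lemma rval_candidate:
  assumes s: "tables s" and a: "nats s a 0 < 2 * n" and b: "nats s b 0 < 2 * n" and h: "nats s h 0 \<le> budget"
  shows "rval (candidate a b h) s = bound_at (nats s a 0) (nats s b 0) (nats s h 0)"
proof -
  have "nats s h 0 \<le> n" "budget - nats s h 0 \<le> n"
    using h budget_le by auto
  then show ?thesis
    using s a b tables_at(1)[OF s a order_refl, of "nats s h 0"]
      tables_at(2)[OF s b order_refl, of "budget - nats s h 0"] tables_simps[OF s]
    by (simp only: candidate_def bound_at_def rval.simps nval.simps nval_cell ready_simps)
qed

lemma rcost_candidate [simp]: "rcost (candidate a b h) = 53"
  by (simp add: candidate_def)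

definition dominates :: "(nat \<times> nat \<times> nat) set \<Rightarrow> state \<Rightarrow> bool" where
  "dominates S s \<longleftrightarrow> (\<forall>(a, b, h)\<in>S. thr b \<le> thr a \<longrightarrow> bound_at a b h \<le> reals s ''value'' 0)"

definition found :: "state \<Rightarrow> bool" where
  "found s \<longleftrightarrow> tables s \<and> nats s ''A'' 0 < 2 * n \<and> nats s ''B'' 0 < 2 * n \<and> nats s ''H'' 0 \<le> budget \<and>
     thr (nats s ''B'' 0) \<le> thr (nats s ''A'' 0) \<and>
     reals s ''value'' 0 = bound_at (nats s ''A'' 0) (nats s ''B'' 0) (nats s ''H'' 0)"

lemma better_wp:
  assumes "found s" "dominates S s" "nats s ''a'' 0 = a" "nats s ''b'' 0 = b" "nats s ''h'' 0 = h"
    and "a < 2 * n" "b < 2 * n" "h \<le> budget"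
  shows "wp (Cond (BAnd (BNot (RLess (RCell ''v'' (NVar ''a'')) (RCell ''v'' (NVar ''b''))))
               (RLess (RVar ''value'') (candidate ''a'' ''b'' ''h'')))
           (Seq (NAssign ''A'' (NConst 0) (NVar ''a''))
           (Seq (NAssign ''B'' (NConst 0) (NVar ''b''))
           (Seq (NAssign ''H'' (NConst 0) (NVar ''h''))
             (RAssign ''value'' (NConst 0) (candidate ''a'' ''b'' ''h'')))))
           Skip)
    (\<lambda>t s'. t \<le> 200 \<and> found s' \<and> dominates (insert (a, b, h) S) s' \<and>
      nats s' ''a'' 0 = a \<and> nats s' ''b'' 0 = b \<and> nats s' ''h'' 0 = h) s"
proof -
  have tab: "tables s"
    using assms(1) by (simp add: found_def)
  note v = tables_simps(5)[OF tab]
  have cand: "rval (candidate ''a'' ''b'' ''h'') s = bound_at a b h"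
    using rval_candidate[OF tab] assms by simp
  show ?thesis
  proof (cases "thr b \<le> thr a \<and> reals s ''value'' 0 < bound_at a b h")
    case True
    let ?s = "nat_upd ''H'' 0 h (nat_upd ''B'' 0 b (nat_upd ''A'' 0 a s))"
    have "rval (candidate ''a'' ''b'' ''h'') ?s = bound_at a b h"
      using rval_candidate[of ?s "''a''" "''b''" "''h''"] tab assms by simp
    with True show ?thesis
      using assms tab by (auto simp: cand v found_def dominates_def)
  next
    case False
    then show ?thesis
      using assms by (auto simp: cand v dominates_def)
  qed
qed

lemma search_wp:
  assumes "tables s"
  shows "wp search_prog (\<lambda>t s'. t \<le> 80 + 2 * n * (11 + 2 * n * (11 + Suc n * 214 + 14) + 14) \<and>
    found s' \<and> dominates ({..<2 * n} \<times> {..<2 * n} \<times> {..budget}) s') s"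
proof -
  let ?U = "{..<2 * n}" and ?V = "{..budget}"
  let ?s = "nat_upd ''H'' 0 0 (nat_upd ''B'' 0 0 (nat_upd ''A'' 0 0 s))"
  have cand: "rval (candidate ''A'' ''B'' ''H'') ?s = bound_at 0 0 0"
    using rval_candidate[of ?s "''A''" "''B''" "''H''"] assms n_pos by simp
  define I where "I S s \<longleftrightarrow> found s \<and> dominates S s" for S s
  have I_upd: "I S (nat_upd a i v s) = I S s" if "a = ''a'' \<or> a = ''b'' \<or> a = ''h''" for S a i v s
    using that by (auto simp: I_def found_def dominates_def)
  have I_simps: "nats s ''n'' 0 = n \<and> nats s ''G'' 0 = budget" if "I S s" for S s
    using that by (auto simp: I_def found_def tables_simps)
  \<comment> \<open>These are the triples that precede \<open>(a, b, h)\<close> lexicographically,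
    that is, those already examined by the three nested loops.\<close>
  define D where "D a b h = {..<a} \<times> ?U \<times> ?V \<union> {a} \<times> {..<b} \<times> ?V \<union> {a} \<times> {b} \<times> {..<h}" for a b h :: nat
  have D_0: "D 0 0 0 = {}" and D_end: "D (2 * n) 0 0 = ?U \<times> ?U \<times> ?V"
    and D_a: "D a (2 * n) 0 = D (Suc a) 0 0" and D_b: "D a b (Suc budget) = D a (Suc b) 0"
    and D_h: "insert (a, b, h) (D a b h) = D a b (Suc h)" for a b h :: nat
    unfolding D_def by auto
  show ?thesis
    unfolding search_prog_def wp_Seq wp_NAssign wp_RAssign
  proof (rule wp_For[where m = "2 * n" and \<tau> = "11 + 2 * n * (11 + Suc n * 214 + 14)" and
        I = "\<lambda>a. I (D a 0 0)"], goal_cases init bound step final)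
    case init
    show ?case
      using assms n_pos cand by (simp add: D_0 I_def found_def dominates_def)
  next
    case (bound a s)
    then show ?case
      by (simp add: I_simps)
  next
    case (step a s)
    note a = \<open>a < 2 * n\<close>
    show ?case
    proof (rule wp_For[where m = "2 * n" and \<tau> = "11 + Suc n * 214" and
          I = "\<lambda>b s. nats s ''a'' 0 = a \<and> I (D a b 0) s"], goal_cases init bound step final)
      case init
      show ?case
        using step by (simp add: I_upd)
    next
      case (bound b s)
      then show ?case
        using I_simps by auto
    next
      case (step b s)
      note b = \<open>b < 2 * n\<close>
      show ?case
      proof (rule wp_For[where m = "Suc budget" and \<tau> = 200 and
            I = "\<lambda>h s. nats s ''a'' 0 = a \<and> nats s ''b'' 0 = b \<and> I (D a b h) s"],
          goal_cases init bound step final)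
        case init
        show ?case
          using step by (simp add: I_upd)
      next
        case (bound h s)
        then show ?case
          using I_simps by auto
      next
        case (step h s)
        then have "found s" "dominates (D a b h) s" "nats s ''a'' 0 = a" "nats s ''b'' 0 = b"
            "nats s ''h'' 0 = h" "h \<le> budget"
          by (simp_all add: I_def)
        note better = better_wp[OF this(1-5) a b this(6), unfolded D_h]
        show ?case
          by (rule wp_mono[OF better]) (simp add: I_upd, simp add: I_def)
      next
        case (final t s')
        \<comment> \<open>The innermost loop runs over the budget, and the cap at \<open>n\<close>
          keeps the search cubic.\<close>
        have "Suc budget * 214 \<le> Suc n * 214"
          using budget_le by simp
        then show ?case
          using final by (simp add: I_upd D_b)
      qed
    next
      case (final t s')
      then show ?case
        by (simp add: I_upd D_a)
    qed
  next
    case (final t s')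
    then show ?case
      by (simp add: I_def D_end)
  qed
qed

section \<open>Recovering the raised items from the tables\<close>

text \<open>The tables store no decisions. Comparing an entry with the raised branch of its maximum
  recovers one, as arithmetic is exact; if the comparison fails, the other branch attains the
  maximum. Ties are resolved in favour of raising.\<close>

lemma trace_step_wp:
  assumes s: "tables s" "nats s ''b'' 0 = b" "nats s ''g'' 0 = g" "nats s ''j'' 0 = j"
    and bnd: "b < 2 * n" "g \<le> n" "j < n" and i: "i = n - j"
    and T: "\<sigma> = 1 \<and> T = ''T1'' \<or> \<sigma> = 0 \<and> T = ''T0''"
    and Q: "\<And>t s'. t \<le> 200 \<Longrightarrow> tables s' \<Longrightarrow> nats s' ''b'' 0 = b \<Longrightarrow> nats s' ''j'' 0 = j \<Longrightarrow>
      (\<exists>raised. nats s' ''g'' 0 = (if raised then g - 1 else g) \<and> (raised \<longrightarrow> 0 < g) \<and>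
        opt \<sigma> b i g = opt \<sigma> b (i - 1) (if raised then g - 1 else g) +
          share \<sigma> (thr b) (if raised then hi else lo) i \<and>
        (\<forall>l. reals s' ''c'' l = (if l = i \<and> x i = \<sigma> then if raised then hi i else lo i else reals s ''c'' l)))
      \<Longrightarrow> Q t s'"
  shows "wp (Seq (NAssign ''i'' (NConst 0) (NSub (NVar ''n'') (NVar ''j'')))
       (Seq (NAssign ''m'' (NConst 0) (cell (NVar ''b'') (NVar ''i'') (NVar ''g'')))
       (Seq (share_prog \<sigma> ''hi'' ''r'')
         (Cond (BAnd (NLess (NConst 0) (NVar ''g''))
               (REq (RCell T (NVar ''m'')) (RAdd (RCell T diag_cell) (RVar ''r''))))
           (Seq (NAssign ''g'' (NConst 0) (NSub (NVar ''g'') (NConst 1)))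
             (Cond (NEq (NCell ''x'' (NVar ''i'')) (NConst \<sigma>))
               (RAssign ''c'' (NVar ''i'') (RCell ''hi'' (NVar ''i''))) Skip))
           (Cond (NEq (NCell ''x'' (NVar ''i'')) (NConst \<sigma>))
             (RAssign ''c'' (NVar ''i'') (RCell ''lo'' (NVar ''i''))) Skip))))) Q s"
proof -
  obtain i' where i': "i = Suc i'"
    using bnd i by (metis Suc_diff_Suc)
  have i_bnd: "0 < i" "i \<le> n"
    using bnd i by auto
  note rdy = tables_simps(1)[OF s(1)]
  define q where "q = idx b i g"
  define q2 where "q2 = idx b i' (g - 1)"
  let ?s1 = "nat_upd ''i'' (nval (NConst 0) s) (nval (NSub (NVar ''n'') (NVar ''j'')) s) s"
  let ?s = "nat_upd ''m'' (nval (NConst 0) ?s1) q ?s1"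
  have q: "nval (cell (NVar ''b'') (NVar ''i'') (NVar ''g'')) ?s1 = q"
    using s i by (simp add: q_def tables_simps)
  have q2: "q - Suc (Suc n) = q2" if "0 < g"
    using that by (simp add: q_def q2_def i')
  have Tq: "reals s T q = opt \<sigma> b i g"
    unfolding q_def using T tables_at[OF s(1) bnd(1) i_bnd(2) bnd(2)] by auto
  have Tq2: "reals s T q2 = opt \<sigma> b i' (g - 1)"
    unfolding q2_def using T tables_at[OF s(1) bnd(1), of i' "g - 1"] bnd i_bnd i' by auto
  have opt_rec: "opt \<sigma> b i g = (if g = 0 then opt \<sigma> b i' g + share \<sigma> (thr b) lo i
      else max (opt \<sigma> b i' g + share \<sigma> (thr b) lo i) (opt \<sigma> b i' (g - 1) + share \<sigma> (thr b) hi i))"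
    by (simp add: opt_def i')
  have T_neq: "''r'' \<noteq> T"
    using T by auto
  show ?thesis
    unfolding wp_Seq wp_NAssign q
  proof (rule share_wp[where i = i and b = b and c = hi], goal_cases)
    case (8 t)
    let ?s2 = "real_upd ''r'' 0 (share \<sigma> (thr b) hi i) ?s"
    define raised where "raised \<longleftrightarrow> 0 < g \<and> opt \<sigma> b i g = opt \<sigma> b i' (g - 1) + share \<sigma> (thr b) hi i"
    have test: "bval (BAnd (NLess (NConst 0) (NVar ''g''))
        (REq (RCell T (NVar ''m'')) (RAdd (RCell T diag_cell) (RVar ''r'')))) ?s2 \<longleftrightarrow> raised"
      unfolding raised_def using T_neq q2 Tq Tq2 s rdy by (auto simp: ready_simps)
    have fin: "Q u s'" if "u \<le> 200" "tables s'" "nats s' ''b'' 0 = b" "nats s' ''j'' 0 = j"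
        "nats s' ''g'' 0 = (if raised then g - 1 else g)"
        "\<And>l. reals s' ''c'' l = (if l = i \<and> x i = \<sigma> then if raised then hi i else lo i else reals s ''c'' l)"
      for u s'
    proof (rule Q[OF that(1-4)], intro exI[of _ raised] conjI)
      show "opt \<sigma> b i g = opt \<sigma> b (i - 1) (if raised then g - 1 else g) +
          share \<sigma> (thr b) (if raised then hi else lo) i"
        using opt_rec by (auto simp: raised_def i' max_def split: if_splits)
    qed (use that in \<open>auto simp: raised_def\<close>)
    have xi: "nats s ''x'' i = x i" and ci: "reals s ''hi'' i = hi i" "reals s ''lo'' i = lo i"
      using rdy i_bnd by (simp_all add: ready_simps)
    have ni: "nats s ''n'' 0 - j = i"
      using rdy i by (simp add: ready_simps)
    show ?case
      unfolding wp_Cond[of "BAnd _ _"] test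
      using 8 s xi ci ni by (cases raised; cases "x i = \<sigma>"; simp; intro fin; simp)
  qed (use s rdy bnd i i_bnd in \<open>simp_all add: ready_simps\<close>)
qed

lemma trace_wp:
  assumes s: "tables s" "nats s B 0 = b" and bnd: "b < 2 * n" "g\<^sub>0 \<le> n" "ncost h \<le> 10"
    and h: "nval h (nat_upd ''b'' 0 b s) = g\<^sub>0"
    and T: "\<sigma> = 1 \<and> T = ''T1'' \<or> \<sigma> = 0 \<and> T = ''T0''"
  shows "wp (trace_prog \<sigma> T B h) (\<lambda>t s'. t \<le> 30 + n * 212 \<and> tables s' \<and>
    (\<exists>R\<subseteq>{1..n}. card R \<le> g\<^sub>0 \<and>
      opt \<sigma> b n g\<^sub>0 = (\<Sum>l\<in>{1..n}. share \<sigma> (thr b) (if l \<in> R then hi else lo) l) \<and>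
      (\<forall>l\<in>{1..n}. reals s' ''c'' l = (if x l = \<sigma> then if l \<in> R then hi l else lo l else reals s ''c'' l)))) s"
proof -
  \<comment> \<open>Items above \<open>n - j\<close> are decided and \<open>R\<close> holds the
    raised ones; the optimum splits into their contributions and the entry for the remaining items
    and budget.\<close>
  define I where "I j s' \<longleftrightarrow> tables s' \<and> nats s' ''b'' 0 = b \<and> nats s' ''g'' 0 \<le> n \<and>
    (\<exists>R\<subseteq>{n - j<..n}. card R + nats s' ''g'' 0 \<le> g\<^sub>0 \<and>
      opt \<sigma> b n g\<^sub>0 = opt \<sigma> b (n - j) (nats s' ''g'' 0) +
        (\<Sum>l\<in>{n - j<..n}. share \<sigma> (thr b) (if l \<in> R then hi else lo) l) \<and>
      (\<forall>l. reals s' ''c'' l =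
        (if l \<in> {n - j<..n} \<and> x l = \<sigma> then if l \<in> R then hi l else lo l else reals s ''c'' l)))" for j s'
  show ?thesis
    unfolding trace_prog_def wp_Seq wp_NAssign
  proof (rule wp_For[where I = I and m = n and \<tau> = 200], goal_cases init bound step final)
    case init
    show ?case
      using s bnd h by (auto simp: I_def intro!: exI[of _ "{}"])
  next
    case (bound j s')
    then show ?case
      by (simp add: I_def tables_simps)
  next
    case (step j s')
    define i where "i = n - j"
    have i: "0 < i" "i \<le> n" "n - Suc j = i - 1" and j: "j < n"
      using step by (auto simp: i_def)
    define g where "g = nats s' ''g'' 0"
    from step obtain R where R: "R \<subseteq> {i<..n}" "card R + g \<le> g\<^sub>0"
        "opt \<sigma> b n g\<^sub>0 = opt \<sigma> b i g + (\<Sum>l\<in>{i<..n}. share \<sigma> (thr b) (if l \<in> R then hi else lo) l)"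
        "\<And>l. reals s' ''c'' l =
          (if l \<in> {i<..n} \<and> x l = \<sigma> then if l \<in> R then hi l else lo l else reals s ''c'' l)"
      unfolding I_def g_def i_def by auto
    have s': "tables s'" "nats s' ''b'' 0 = b" "nats s' ''g'' 0 = g" "nats s' ''j'' 0 = j" "g \<le> n"
      using step by (auto simp: I_def g_def)
    have next_set: "{i - 1<..n} = insert i {i<..n}"
      using i by auto
    show ?case
    proof (rule trace_step_wp[OF s'(1-4) bnd(1) s'(5) j i_def T], goal_cases)
      case (1 t s'')
      from 1(5) obtain raised where r: "nats s'' ''g'' 0 = (if raised then g - 1 else g)" "raised \<longrightarrow> 0 < g"
        "opt \<sigma> b i g = opt \<sigma> b (i - 1) (if raised then g - 1 else g) +
          share \<sigma> (thr b) (if raised then hi else lo) i"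
        "\<And>l. reals s'' ''c'' l = (if l = i \<and> x i = \<sigma> then if raised then hi i else lo i else reals s' ''c'' l)"
        by blast
      define R' where "R' = (if raised then insert i R else R)"
      have "i \<notin> R" "finite R"
        using R(1) finite_subset by auto
      then have "card R' + nats s'' ''g'' 0 \<le> g\<^sub>0"
        using R(2) r(1,2) by (auto simp: R'_def)
      moreover have "(\<Sum>l\<in>{i<..n}. share \<sigma> (thr b) (if l \<in> R' then hi else lo) l) =
          (\<Sum>l\<in>{i<..n}. share \<sigma> (thr b) (if l \<in> R then hi else lo) l)"
        by (rule sum.cong) (auto simp: R'_def)
      then have "opt \<sigma> b n g\<^sub>0 = opt \<sigma> b (i - 1) (nats s'' ''g'' 0) +
          (\<Sum>l\<in>{i - 1<..n}. share \<sigma> (thr b) (if l \<in> R' then hi else lo) l)"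
        using R(3) r(1,3) \<open>i \<notin> R\<close> unfolding next_set by (simp add: R'_def)
      moreover have "R' \<subseteq> {i - 1<..n}"
        using R(1) unfolding R'_def next_set by auto
      moreover have "reals s'' ''c'' l =
          (if l \<in> {i - 1<..n} \<and> x l = \<sigma> then if l \<in> R' then hi l else lo l else reals s ''c'' l)" for l
        using r(4)[of l] R(4)[of l] \<open>i \<notin> R\<close> unfolding next_set by (auto simp: R'_def)
      ultimately have "\<exists>R\<subseteq>{i - 1<..n}. card R + nats s'' ''g'' 0 \<le> g\<^sub>0 \<and>
          opt \<sigma> b n g\<^sub>0 = opt \<sigma> b (i - 1) (nats s'' ''g'' 0) +
            (\<Sum>l\<in>{i - 1<..n}. share \<sigma> (thr b) (if l \<in> R then hi else lo) l) \<and>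
          (\<forall>l. reals s'' ''c'' l =
            (if l \<in> {i - 1<..n} \<and> x l = \<sigma> then if l \<in> R then hi l else lo l else reals s ''c'' l))"
        by blast
      moreover have "nats s'' ''g'' 0 \<le> n"
        using r(1) s'(5) by auto
      ultimately show ?case
        using 1(1-4) unfolding I_def i(3) by simp
    qed
  next
    case (final t s')
    have set: "{n - n<..n} = {1..n}"
      by auto
    have opt_0: "opt \<sigma> b (n - n) g = 0" for g
      by (simp add: opt_def)
    from final(2) obtain R where R: "R \<subseteq> {1..n}" "card R + nats s' ''g'' 0 \<le> g\<^sub>0"
        "opt \<sigma> b n g\<^sub>0 = (\<Sum>l\<in>{1..n}. share \<sigma> (thr b) (if l \<in> R then hi else lo) l)"
        "\<And>l. reals s' ''c'' l =
          (if l \<in> {1..n} \<and> x l = \<sigma> then if l \<in> R then hi l else lo l else reals s ''c'' l)"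
      unfolding I_def set opt_0 add_0 by blast
    have "card R \<le> g\<^sub>0" and "\<forall>l\<in>{1..n}. reals s' ''c'' l =
        (if x l = \<sigma> then if l \<in> R then hi l else lo l else reals s ''c'' l)"
      using R(2,4) by auto
    moreover have "tables s'"
      using final(2) by (simp add: I_def)
    moreover have "1 + ncost (NConst 0) + ncost (NVar B) + (1 + ncost (NConst 0) + ncost h + t) \<le> 30 + n * 212"
      using final(1) bnd(3) by simp
    ultimately show ?case
      using R(1,3) by blast
  qed
qed

section \<open>Optimality of the computed scenario\<close>

text \<open>Cardinalities are integers and at most \<open>n\<close>, so neither rounding \<Gamma>
  down nor capping it excludes a set.\<close>

lemma card_le_budget_iff:
  assumes "S \<subseteq> {1..n}"
  shows "real (card S) \<le> \<Gamma> \<longleftrightarrow> card S \<le> budget"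
proof -
  have "card S \<le> n"
    using card_mono[OF _ assms] by simp
  then show ?thesis
    using \<Gamma>_nonneg by (simp add: budget_def) linarith
qed

definition raise :: "nat set \<Rightarrow> nat \<Rightarrow> real" where
  "raise S = restrict (\<lambda>i. if i \<in> S then hi i else lo i) {1..n}"

lemma raise_in_scenarios:
  assumes S: "S \<subseteq> {1..n}" and card: "card S \<le> budget"
  shows "raise S \<in> scenarios n lo hi \<Gamma>"
proof -
  define \<delta> where "\<delta> i = (if i \<in> S then hi i - lo i else 0)" for i
  \<comment> \<open>The inequality can be strict: items of \<open>S\<close> with
    \<open>hi i = lo i\<close> are not counted as raised.\<close>
  have "card {i \<in> {1..n}. \<delta> i \<noteq> 0} \<le> card S"
    using finite_subset[OF S] by (intro card_mono) (auto simp: \<delta>_def)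
  then have "real (card {i \<in> {1..n}. \<delta> i \<noteq> 0}) \<le> \<Gamma>"
    using card by (subst card_le_budget_iff) auto
  moreover have "raise S = restrict (\<lambda>i. lo i + \<delta> i) {1..n}"
    unfolding raise_def by (rule restrict_ext) (simp add: \<delta>_def)
  moreover have "\<forall>i\<in>{1..n}. \<delta> i \<in> {0, hi i - lo i}"
    by (simp add: \<delta>_def)
  ultimately show ?thesis
    unfolding scenarios_def by blast
qed

lemma scenario_is_raise:
  assumes "c \<in> scenarios n lo hi \<Gamma>"
  obtains S where "S \<subseteq> {1..n}" "card S \<le> budget" "c = raise S"
proof -
  from assms obtain \<delta> where c: "c = restrict (\<lambda>i. lo i + \<delta> i) {1..n}"
    and \<delta>: "\<forall>i\<in>{1..n}. \<delta> i \<in> {0, hi i - lo i}" "real (card {i \<in> {1..n}. \<delta> i \<noteq> 0}) \<le> \<Gamma>"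
    unfolding scenarios_def by blast
  let ?S = "{i \<in> {1..n}. \<delta> i \<noteq> 0}"
  have sub: "?S \<subseteq> {1..n}"
    by blast
  have "c = raise ?S"
    unfolding c raise_def by (rule restrict_ext) (use \<delta>(1) in auto)
  then show ?thesis
    using that[OF sub] card_le_budget_iff[OF sub] \<delta>(2) by blast
qed

lemma raise_eq_thr:
  assumes "i \<in> {1..n}"
  obtains a where "a < 2 * n" "raise S i = thr a"
proof (cases "i \<in> S")
  case True
  then show ?thesis
    using assms that[of "2 * (i - 1) + 1"] by (auto simp: raise_def thr_def)
next
  case False
  then show ?thesis
    using assms that[of "2 * (i - 1)"] by (auto simp: raise_def thr_def)
qed

text \<open>Shares vanish off the side \<open>\<sigma>\<close>, so only the raised items on that
  side have to fit into the budget \<open>g\<close>.\<close>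

lemma sum_share_le_opt:
  assumes "S \<subseteq> {1..n}" "card {i \<in> S. x i = \<sigma>} \<le> g"
  shows "(\<Sum>i\<in>{1..n}. share \<sigma> (thr a) (raise S) i) \<le> opt \<sigma> a n g"
proof -
  let ?R = "{i \<in> S. x i = \<sigma>}"
  have "(\<Sum>i\<in>{1..n}. share \<sigma> (thr a) (raise S) i) =
      (\<Sum>i\<in>{1..n}. if i \<in> ?R then share \<sigma> (thr a) hi i else share \<sigma> (thr a) lo i)"
    by (rule sum.cong) (auto simp: share_def raise_def)
  also have "\<dots> \<le> opt \<sigma> a n g"
    unfolding opt_def using assms by (intro sum_le_best) auto
  finally show ?thesis .
qed

text \<open>Strong duality expresses the recovery cost by thresholds that are costs of items and
  hence of the form \<open>thr a\<close>. Splitting the raised set by side then bounds each part by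
  a table entry.\<close>

lemma rec_cost_le_bound_at:
  assumes "c \<in> scenarios n lo hi \<Gamma>"
  obtains a b h where "a < 2 * n" "b < 2 * n" "h \<le> budget" "thr b \<le> thr a"
    "rec_cost n p k x c \<le> bound_at a b h"
proof -
  from assms obtain S where S: "S \<subseteq> {1..n}" "card S \<le> budget" "c = raise S"
    by (rule scenario_is_raise)
  obtain i j where ij: "i \<in> {1..n}" "j \<in> {1..n}" "c j \<le> c i" "rec_cost n p k x c = dual c (c i) (c j)"
    by (rule rec_cost_eq_dual)
  obtain a b where ab: "a < 2 * n" "c i = thr a" "b < 2 * n" "c j = thr b"
    using raise_eq_thr[OF ij(1)] raise_eq_thr[OF ij(2)] S(3) by metis
  \<comment> \<open>The budget is split at the number of raised items inside \<open>x\<close>; the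
    remainder covers those outside.\<close>
  let ?h = "card {i \<in> S. x i = 1}"
  have fin: "finite S"
    using S(1) finite_subset by blast
  have "S = {i \<in> S. x i = 1} \<union> {i \<in> S. x i = 0}"
    using S(1) x_cases by blast
  then have "card S = ?h + card {i \<in> S. x i = 0}"
    using fin by (subst card_Un_disjoint[symmetric]) auto
  then have "?h \<le> budget" "card {i \<in> S. x i = 0} \<le> budget - ?h"
    using S(2) by auto
  moreover from this have "dual c (thr a) (thr b) \<le> bound_at a b ?h"
    using sum_share_le_opt[OF S(1), of 1 ?h a] sum_share_le_opt[OF S(1), of 0 "budget - ?h" b]
    by (simp add: dual_def bound_at_def S(3))
  ultimately show ?thesis
    using that ab ij by simp
qed

text \<open>The two raised sets are merged by using each on its own side only, where alone its
  shares can be nonzero.\<close>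

lemma dual_eq_bound_at:
  assumes "R\<^sub>1 \<subseteq> {1..n}" "opt 1 a n h = (\<Sum>l\<in>{1..n}. share 1 (thr a) (if l \<in> R\<^sub>1 then hi else lo) l)"
    and "R\<^sub>0 \<subseteq> {1..n}" "opt 0 b n (budget - h) = (\<Sum>l\<in>{1..n}. share 0 (thr b) (if l \<in> R\<^sub>0 then hi else lo) l)"
    and S: "S = {l \<in> {1..n}. if x l = 1 then l \<in> R\<^sub>1 else l \<in> R\<^sub>0}"
  shows "dual (raise S) (thr a) (thr b) = bound_at a b h"
proof -
  have "(\<Sum>l\<in>{1..n}. share 1 (thr a) (raise S) l) =
      (\<Sum>l\<in>{1..n}. share 1 (thr a) (if l \<in> R\<^sub>1 then hi else lo) l)"
    "(\<Sum>l\<in>{1..n}. share 0 (thr b) (raise S) l) =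
      (\<Sum>l\<in>{1..n}. share 0 (thr b) (if l \<in> R\<^sub>0 then hi else lo) l)"
    by (auto intro!: sum.cong simp: share_def raise_def S)
  then show ?thesis
    using assms by (simp add: dual_def bound_at_def)
qed

lemma rec_cost_le_arec_value:
  "c \<in> scenarios n lo hi \<Gamma> \<Longrightarrow> rec_cost n p k x c \<le> arec_value n p k x lo hi \<Gamma>"
  unfolding arec_value_def using finite_scenarios by (intro Max_ge) auto

lemma dual_le_rec_cost: "v\<^sub>0 \<le> v\<^sub>1 \<Longrightarrow> dual c v\<^sub>1 v\<^sub>0 \<le> rec_cost n p k x c"
  unfolding rec_cost_def using finite_sel_rec sel_rec_nonempty instance_ok dual_le_cost
  by (intro Min.boundedI) (auto simp: arec_instance_def)

text \<open>A closed chain of inequalities: the optimum is at most some admissible bound, which is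
  at most \<open>value\<close>; by weak duality \<open>value\<close> is at most the recovery cost of
  the merged scenario, which is at most the optimum.\<close>

lemma arec_output_if_dominates:
  assumes s: "dominates ({..<2 * n} \<times> {..<2 * n} \<times> {..budget}) s"
    and val: "reals s ''value'' 0 = bound_at a b h" and thr: "thr b \<le> thr a" and h: "h \<le> budget"
    and R1: "R\<^sub>1 \<subseteq> {1..n}" "card R\<^sub>1 \<le> h"
      "opt 1 a n h = (\<Sum>l\<in>{1..n}. share 1 (thr a) (if l \<in> R\<^sub>1 then hi else lo) l)"
    and R0: "R\<^sub>0 \<subseteq> {1..n}" "card R\<^sub>0 \<le> budget - h"
      "opt 0 b n (budget - h) = (\<Sum>l\<in>{1..n}. share 0 (thr b) (if l \<in> R\<^sub>0 then hi else lo) l)"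
    and c: "\<And>l. l \<in> {1..n} \<Longrightarrow>
      reals s ''c'' l = (if (if x l = 1 then l \<in> R\<^sub>1 else l \<in> R\<^sub>0) then hi l else lo l)"
  shows "arec_output n p k x lo hi \<Gamma> s"
proof -
  define S where "S = {l \<in> {1..n}. if x l = 1 then l \<in> R\<^sub>1 else l \<in> R\<^sub>0}"
  \<comment> \<open>Merging drops the items raised on the wrong side, so the two budgets still
    suffice.\<close>
  have "card S \<le> card (R\<^sub>1 \<union> R\<^sub>0)"
    using R1(1) R0(1) by (intro card_mono) (auto simp: S_def intro: finite_subset split: if_splits)
  also have "\<dots> \<le> budget"
    using card_Un_le[of R\<^sub>1 R\<^sub>0] R1(2) R0(2) h by linarith
  finally have scen: "raise S \<in> scenarios n lo hi \<Gamma>"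
    by (intro raise_in_scenarios) (auto simp: S_def)
  let ?v = "arec_value n p k x lo hi \<Gamma>"
  have "?v \<in> rec_cost n p k x ` scenarios n lo hi \<Gamma>"
    unfolding arec_value_def using finite_scenarios scenarios_nonempty[OF \<Gamma>_nonneg] by (intro Max_in) auto
  then obtain c' where c': "c' \<in> scenarios n lo hi \<Gamma>" "rec_cost n p k x c' = ?v"
    by auto
  obtain a' b' h' where abh: "a' < 2 * n" "b' < 2 * n" "h' \<le> budget" "thr b' \<le> thr a'" "?v \<le> bound_at a' b' h'"
    using rec_cost_le_bound_at[OF c'(1)] unfolding c'(2) .
  have "(a', b', h') \<in> {..<2 * n} \<times> {..<2 * n} \<times> {..budget}"
    using abh by simp
  then have "bound_at a' b' h' \<le> reals s ''value'' 0"
    using s abh(4) unfolding dominates_def by blast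
  with abh(5) have lower: "?v \<le> reals s ''value'' 0"
    by simp
  have upper: "reals s ''value'' 0 \<le> rec_cost n p k x (raise S)"
    using dual_le_rec_cost[OF thr, of "raise S"]
    unfolding val dual_eq_bound_at[OF R1(1,3) R0(1,3) S_def] .
  have "rec_cost n p k x (raise S) = ?v" "reals s ''value'' 0 = ?v"
    using rec_cost_le_arec_value[OF scen] lower upper by simp_all
  moreover have "\<forall>l\<in>{1..n}. reals s ''c'' l = raise S l"
    using c by (auto simp: raise_def S_def)
  ultimately show ?thesis
    unfolding arec_output_def using scen by blast
qed

section \<open>Running time and composition of the phases\<close>

text \<open>The left side adds the bounds of the seven phases in program order; the two tables and
  the search are the cubic ones.\<close>

lemma time_bound:
  "12 + n * 112 + (16 + n * 112 + (11 + 2 * n * (9 + Suc n * (9 + Suc n * 212 + 12) + 14) +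
    (11 + 2 * n * (9 + Suc n * (9 + Suc n * 212 + 12) + 14) +
    (80 + 2 * n * (11 + 2 * n * (11 + Suc n * 214 + 14) + 14) + (30 + n * 212 + (30 + n * 212)))))) \<le> 10000 * n ^ 3"
  (is "?t \<le> _")
proof -
  have "1 \<le> n"
    using n_pos by simp
  then have "n \<le> n * n" and "n * n \<le> n * n * n"
    by simp_all
  \<comment> \<open>The coefficients are rounded up so that their sum stays below 10000; lower
    powers are absorbed since \<open>1 \<le> n\<close>.\<close>
  have "?t \<le> 400 + 2000 * n + 3000 * (n * n) + 3000 * (n * n * n)"
    by (simp add: algebra_simps)
  also have "\<dots> \<le> 10000 * (n * n * n)"
    using \<open>1 \<le> n\<close> \<open>n \<le> n * n\<close> \<open>n * n \<le> n * n * n\<close> by linarith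
  finally show ?thesis
    by (simp only: power3_eq_cube)
qed

lemma arec_prog_wp:
  assumes "input s"
  shows "wp arec_prog (\<lambda>t s'. t \<le> 10000 * n ^ 3 \<and> arec_output n p k x lo hi \<Gamma> s') s"
  unfolding arec_prog_def wp_Seq
proof (rule wp_mono[OF budget_wp[OF assms]], elim conjE, goal_cases)
  case (1 t1 s1)
  show ?case
  proof (rule wp_mono[OF threshold_wp[OF 1(2,3)]], elim conjE, goal_cases)
    case (1 t2 s2)
    show ?case
    proof (rule wp_mono[OF table_wp[OF 1(2) disjI2[OF refl]]], elim conjE, goal_cases)
      case (1 t3 s3)
      show ?case
      proof (rule wp_frame[OF table_wp[OF 1(2) disjI1[OF refl]]], elim conjE, goal_cases)
        case (1 t4 s4)
        \<comment> \<open>Filling the second table writes only \<open>T0\<close> and the scratch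
          cells \<open>u\<close> and \<open>r\<close> among the real arrays.\<close>
        have "reals s4 ''T1'' = reals s3 ''T1''"
          by (rule 1) (simp add: table_prog_def entry_prog_def share_prog_def)
        then have tab: "tables s4"
          using 1 \<open>filled 1 ''T1'' idx_max s3\<close> by (simp add: tables_def filled_def)
        show ?case
        proof (rule wp_mono[OF search_wp[OF tab]], elim conjE, goal_cases)
          case (1 t5 s5)
          define a where "a = nats s5 ''A'' 0"
          define b where "b = nats s5 ''B'' 0"
          define h where "h = nats s5 ''H'' 0"
          have tab5: "tables s5"
            using 1 by (simp add: found_def)
          have fnd: "a < 2 * n" "b < 2 * n" "h \<le> budget" "thr b \<le> thr a" "reals s5 ''value'' 0 = bound_at a b h"
            using 1 by (simp_all add: found_def a_def b_def h_def)
          have hn: "h \<le> n" "budget - h \<le> n"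
            using fnd(3) budget_le by auto
          have tr1: "wp (trace_prog 1 ''T1'' ''A'' (NVar ''H'')) (\<lambda>t s'. t \<le> 30 + n * 212 \<and> tables s' \<and>
              (\<exists>R\<subseteq>{1..n}. card R \<le> h \<and>
                opt 1 a n h = (\<Sum>l\<in>{1..n}. share 1 (thr a) (if l \<in> R then hi else lo) l) \<and>
                (\<forall>l\<in>{1..n}. reals s' ''c'' l =
                  (if x l = 1 then if l \<in> R then hi l else lo l else reals s5 ''c'' l)))) s5"
            using tab5 fnd(1) hn by (intro trace_wp) (auto simp: a_def h_def)
          show ?case
          proof (rule wp_frame[OF tr1], elim conjE exE, goal_cases)
            case (1 t6 s6 R1)
            have n6: "nats s6 ''B'' = nats s5 ''B''" "nats s6 ''H'' = nats s5 ''H''"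
              and v6: "reals s6 ''value'' = reals s5 ''value''"
              by (rule 1; simp add: trace_prog_def share_prog_def)+
            have tr0: "wp (trace_prog 0 ''T0'' ''B'' (NSub (NVar ''G'') (NVar ''H'')))
              (\<lambda>t s'. t \<le> 30 + n * 212 \<and> tables s' \<and>
              (\<exists>R\<subseteq>{1..n}. card R \<le> budget - h \<and>
                opt 0 b n (budget - h) = (\<Sum>l\<in>{1..n}. share 0 (thr b) (if l \<in> R then hi else lo) l) \<and>
                (\<forall>l\<in>{1..n}. reals s' ''c'' l =
                  (if x l = 0 then if l \<in> R then hi l else lo l else reals s6 ''c'' l)))) s6"
              using 1 fnd(2) hn n6 by (intro trace_wp) (auto simp: b_def h_def tables_simps)
            show ?case
            proof (rule wp_frame[OF tr0], elim conjE exE, goal_cases)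
              case (1 t7 s7 R0)
              have v7: "reals s7 ''value'' = reals s6 ''value''"
                by (rule 1; simp add: trace_prog_def share_prog_def)
              have "arec_output n p k x lo hi \<Gamma> s7"
              proof (rule arec_output_if_dominates[of s7 a b h R1 R0])
                show "dominates ({..<2 * n} \<times> {..<2 * n} \<times> {..budget}) s7"
                  using \<open>dominates _ s5\<close> by (simp add: dominates_def v6 v7)
                show "reals s7 ''value'' 0 = bound_at a b h"
                  by (simp add: v6 v7 fnd)
                fix l assume l: "l \<in> {1..n}"
                \<comment> \<open>The first trace sets the cells with \<open>x l = 1\<close>, and
                  the second sets the others without touching these.\<close>
                show "reals s7 ''c'' l = (if (if x l = 1 then l \<in> R1 else l \<in> R0) then hi l else lo l)"
                  using x_cases[OF l] l \<open>\<forall>l\<in>{1..n}. reals s6 ''c'' l = _ l\<close> \<open>\<forall>l\<in>{1..n}. reals s7 ''c'' l = _ l\<close>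
                  by auto
              qed fact+
              moreover have "t1 + (t2 + (t3 + (t4 + (t5 + (t6 + t7))))) \<le> 10000 * n ^ 3"
                by (rule order_trans[OF _ time_bound], intro add_mono; fact)
              ultimately show ?case
                by simp
            qed
          qed
        qed
      qed
    qed
  qed
qed

end

theorem theorem15:
  "\<exists>(prog :: com) (T :: nat \<Rightarrow> nat).
     (\<lambda>n. real (T n)) \<in> O(\<lambda>n. real n ^ 3) \<and>
     (\<forall>n p k x lo hi \<Gamma> s.
        arec_instance n p k x lo hi \<Gamma> \<longrightarrow> arec_input n p k x lo hi \<Gamma> s \<longrightarrow>
        (\<exists>t s'. exec prog s t s' \<and> t \<le> T n \<and> arec_output n p k x lo hi \<Gamma> s'))"
proof (rule exI[of _ arec_prog], rule exI[of _ "\<lambda>n. 10000 * n ^ 3"], intro conjI allI impI)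
  show "(\<lambda>n. real (10000 * n ^ 3)) \<in> O(\<lambda>n. real n ^ 3)"
    by (intro bigoI[of _ 10000]) simp
next
  fix n p k x lo hi \<Gamma> s
  assume "arec_instance n p k x lo hi \<Gamma>" "arec_input n p k x lo hi \<Gamma> s"
  then show "\<exists>t s'. exec arec_prog s t s' \<and> t \<le> 10000 * n ^ 3 \<and> arec_output n p k x lo hi \<Gamma> s'"
    using arec.arec_prog_wp unfolding wp_def arec_def by blast
qed

end
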